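(* Let $\Sigma$ be a sphere with $n\geq 3$ punctures. Then there exist reduced totally elliptic representations $\pi_1\Sigma\to\mathrm{PSL}_2\mathbb{C}$ that are reducible but not unitary.
   Context: A simple closed curve on $\Sigma$ is the free isotopy class of a closed loop on $\Sigma$ that does not self-intersect and is homotopically non-trivial; it is peripheral if it is homotopic to a puncture. An element of $\mathrm{PSL}_2\mathbb{C}$ is elliptic if it belongs to a compact subgroup of $\mathrm{PSL}_2\mathbb{C}$. A representation $\rho\colon\pi_1\Sigma\to \mathrm{PSL}_2\mathbb{C}$ is totally elliptic if every element of $\pi_1\Sigma$ representing a simple closed curve (peripheral curves included) is mapped to an elliptic element. It is reduced if no peripheral curve is mapped to the identity. It is unitary if its image is contained in a compact subgroup of $\mathrm{PSL}_2\mathbb{C}$. It is reducible if its image is conjugate to a subgroup made of upper triangular elements of $\mathrm{PSL}_2\mathbb{C}$. *)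

theory Defs
  imports "HOL-Analysis.Analysis" "HOL-Algebra.Coset"
begin

section \<open>The fundamental group\<close>

definition loops_at :: "'a::real_normed_vector set \<Rightarrow> 'a \<Rightarrow> (real \<Rightarrow> 'a) set" where
  "loops_at S x0 = {p. path p \<and> path_image p \<subseteq> S \<and> pathstart p = x0 \<and> pathfinish p = x0}"

definition loop_class :: "'a::real_normed_vector set \<Rightarrow> (real \<Rightarrow> 'a) \<Rightarrow> (real \<Rightarrow> 'a) set" where
  "loop_class S p = {q. homotopic_paths S p q}"

definition fundamental_group :: "'a::real_normed_vector set \<Rightarrow> 'a \<Rightarrow> (real \<Rightarrow> 'a) set monoid" where
  "fundamental_group S x0 =
     \<lparr>carrier = loop_class S ` loops_at S x0,
      mult = (\<lambda>X Y. {r. \<exists>p\<in>X. \<exists>q\<in>Y. homotopic_paths S (p +++ q) r}),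
      one = loop_class S (linepath x0 x0)\<rparr>"

lemma loop_class_eq_iff:
  assumes "p \<in> loops_at S x0"
  shows "loop_class S p = loop_class S q \<longleftrightarrow> homotopic_paths S p q"
proof
  assume "loop_class S p = loop_class S q"
  moreover have "p \<in> loop_class S p"
    using assms by (simp add: loop_class_def loops_at_def)
  ultimately show "homotopic_paths S p q"
    by (auto simp: loop_class_def intro: homotopic_paths_sym)
next
  assume "homotopic_paths S p q"
  then show "loop_class S p = loop_class S q"
    by (auto simp: loop_class_def intro: homotopic_paths_trans homotopic_paths_sym)
qed

lemma fundamental_group_mult:
  assumes p: "p \<in> loops_at S x0" and q: "q \<in> loops_at S x0"
  shows "loop_class S p \<otimes>\<^bsub>fundamental_group S x0\<^esub> loop_class S q = loop_class S (p +++ q)"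
proof -
  have "homotopic_paths S (p +++ q) r"
    if "homotopic_paths S p p'" "homotopic_paths S q q'" "homotopic_paths S (p' +++ q') r" for p' q' r
  proof -
    have "homotopic_paths S (p +++ q) (p' +++ q')"
      using that p q by (intro homotopic_paths_join) (auto simp: loops_at_def)
    then show ?thesis
      using that(3) by (rule homotopic_paths_trans)
  qed
  moreover have "homotopic_paths S p p" "homotopic_paths S q q"
    using p q by (auto simp: loops_at_def)
  ultimately have "(\<exists>p'. homotopic_paths S p p' \<and> (\<exists>q'. homotopic_paths S q q' \<and>
      homotopic_paths S (p' +++ q') r)) \<longleftrightarrow> homotopic_paths S (p +++ q) r" for r
    by blast
  then show ?thesis
    by (simp add: fundamental_group_def loop_class_def Bex_def)
qed

lemma loops_at_join: "p \<in> loops_at S x0 \<Longrightarrow> q \<in> loops_at S x0 \<Longrightarrow> p +++ q \<in> loops_at S x0"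
  by (auto simp: loops_at_def path_image_join)

lemma group_fundamental_group:
  assumes x0: "x0 \<in> S"
  shows "group (fundamental_group S x0)"
proof -
  let ?G = "fundamental_group S x0"
  have carr: "carrier ?G = loop_class S ` loops_at S x0"
    and one: "\<one>\<^bsub>?G\<^esub> = loop_class S (linepath x0 x0)"
    by (simp_all add: fundamental_group_def)
  have lp: "linepath x0 x0 \<in> loops_at S x0"
    using x0 by (auto simp: loops_at_def)
  show ?thesis
  proof (rule groupI)
    fix X Y assume "X \<in> carrier ?G" "Y \<in> carrier ?G"
    then show "X \<otimes>\<^bsub>?G\<^esub> Y \<in> carrier ?G"
      by (auto simp: carr fundamental_group_mult intro!: imageI loops_at_join)
  next
    show "\<one>\<^bsub>?G\<^esub> \<in> carrier ?G"
      using lp by (simp add: carr one)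
  next
    fix X Y Z assume "X \<in> carrier ?G" "Y \<in> carrier ?G" "Z \<in> carrier ?G"
    then obtain p q r where pqr: "p \<in> loops_at S x0" "q \<in> loops_at S x0" "r \<in> loops_at S x0"
      and [simp]: "X = loop_class S p" "Y = loop_class S q" "Z = loop_class S r"
      by (auto simp: carr)
    have "homotopic_paths S (p +++ (q +++ r)) ((p +++ q) +++ r)"
      using pqr by (intro homotopic_paths_assoc) (auto simp: loops_at_def)
    then have "loop_class S ((p +++ q) +++ r) = loop_class S (p +++ (q +++ r))"
      using pqr loop_class_eq_iff loops_at_join by metis
    then show "X \<otimes>\<^bsub>?G\<^esub> Y \<otimes>\<^bsub>?G\<^esub> Z = X \<otimes>\<^bsub>?G\<^esub> (Y \<otimes>\<^bsub>?G\<^esub> Z)"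
      using pqr by (simp add: fundamental_group_mult loops_at_join)
  next
    fix X assume "X \<in> carrier ?G"
    then obtain p where p: "p \<in> loops_at S x0" and [simp]: "X = loop_class S p"
      by (auto simp: carr)
    have "homotopic_paths S (linepath x0 x0 +++ p) p"
      using p by (intro homotopic_paths_lid') (auto simp: loops_at_def)
    then show "\<one>\<^bsub>?G\<^esub> \<otimes>\<^bsub>?G\<^esub> X = X"
      using p lp by (simp add: one fundamental_group_mult loop_class_eq_iff[OF loops_at_join])
    have r: "reversepath p \<in> loops_at S x0"
      using p by (auto simp: loops_at_def)
    have "homotopic_paths S (reversepath p +++ p) (linepath x0 x0)"
      using p homotopic_paths_linv[of p S] by (auto simp: loops_at_def)
    then have "loop_class S (reversepath p) \<otimes>\<^bsub>?G\<^esub> X = \<one>\<^bsub>?G\<^esub>"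
      using p r by (simp add: one fundamental_group_mult loop_class_eq_iff[OF loops_at_join])
    then show "\<exists>Y\<in>carrier ?G. Y \<otimes>\<^bsub>?G\<^esub> X = \<one>\<^bsub>?G\<^esub>"
      using r by (auto simp: carr)
  qed
qed


section \<open>Simple closed curves on a punctured sphere\<close>

definition punctured_sphere :: "(real^3) set \<Rightarrow> (real^3) set" where
  "punctured_sphere P = sphere 0 1 - P"

text \<open>
  A simple closed curve is a free isotopy class; here we work with the loops representing such
  classes.  Non-triviality and the relations below are invariant under free homotopy, so they
  depend only on the class.
\<close>

definition simple_closed_curve :: "'a::real_normed_vector set \<Rightarrow> (real \<Rightarrow> 'a) \<Rightarrow> bool" where
  "simple_closed_curve S c \<longleftrightarrow>
     simple_path c \<and> pathfinish c = pathstart c \<and> path_image c \<subseteq> S \<and>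
     \<not> (\<exists>a. homotopic_loops S c (linepath a a))"

text \<open>Homotopic to a puncture: freely homotopic, inside the punctured sphere, into every
  neighbourhood of that puncture.\<close>

definition peripheral_curve :: "(real^3) set \<Rightarrow> (real \<Rightarrow> real^3) \<Rightarrow> bool" where
  "peripheral_curve P c \<longleftrightarrow>
     simple_closed_curve (punctured_sphere P) c \<and>
     (\<exists>a\<in>P. \<forall>U. open U \<and> a \<in> U \<longrightarrow>
        (\<exists>d. path_image d \<subseteq> U \<and> homotopic_loops (punctured_sphere P) c d))"

definition represents_curve ::
    "'a::real_normed_vector set \<Rightarrow> (real \<Rightarrow> 'a) set \<Rightarrow> (real \<Rightarrow> 'a) \<Rightarrow> bool" where
  "represents_curve S \<gamma> c \<longleftrightarrow> (\<exists>p\<in>\<gamma>. homotopic_loops S p c)"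


section \<open>The topological group PSL(2,C)\<close>

definition SL2C :: "(complex^2^2) monoid" where
  "SL2C = \<lparr>carrier = {A. det A = 1}, mult = (**), one = mat 1\<rparr>"

definition PSL2C :: "(complex^2^2) set monoid" where
  "PSL2C = SL2C Mod {mat 1, - mat 1}"

text \<open>The quotient topology induced by the projection from SL(2,C); elements of PSL(2,C) are cosets,
  so the preimage of a set of cosets is its union.\<close>

definition PSL2C_topology :: "(complex^2^2) set topology" where
  "PSL2C_topology =
     topology (\<lambda>U. U \<subseteq> carrier PSL2C \<and> openin (top_of_set (carrier SL2C)) (\<Union>U))"

lemma group_SL2C: "group SL2C"
proof (rule groupI)
  fix A assume "A \<in> carrier SL2C"
  then have d: "det A = 1"
    by (simp add: SL2C_def)
  then have "invertible A"
    by (simp add: invertible_det_nz)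
  then obtain B where B: "A ** B = mat 1" "B ** A = mat 1"
    by (auto simp: invertible_def)
  have "det B * det A = 1"
    using B(2) by (metis det_I det_mul)
  then show "\<exists>B\<in>carrier SL2C. B \<otimes>\<^bsub>SL2C\<^esub> A = \<one>\<^bsub>SL2C\<^esub>"
    using B d by (intro bexI[of _ B]) (auto simp: SL2C_def)
qed (auto simp: SL2C_def det_mul matrix_mul_assoc)

lemma matrix_mul_minus_mat1:
  fixes A :: "complex^2^2"
  shows "(- mat 1) ** A = - A" "A ** (- mat 1) = - A"
  by (simp_all add: vec_eq_iff matrix_matrix_mult_def mat_def forall_2 sum_2)

lemma SL2C_center_normal: "{mat 1, - mat 1} \<lhd> SL2C"
proof -
  interpret group SL2C
    by (rule group_SL2C)
  have m: "- mat 1 \<in> carrier SL2C"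
    by (simp add: SL2C_def det_2 mat_def)
  have one: "mat 1 \<in> carrier SL2C" "\<one>\<^bsub>SL2C\<^esub> = mat 1"
    by (simp_all add: SL2C_def)
  have mult: "A \<otimes>\<^bsub>SL2C\<^esub> B = A ** B" for A B
    by (simp add: SL2C_def)
  have inv_m: "inv\<^bsub>SL2C\<^esub> (- mat 1) = - mat 1"
    using m one by (intro inv_equality) (simp_all add: mult matrix_mul_minus_mat1)
  have inv_1: "inv\<^bsub>SL2C\<^esub> (mat 1) = mat 1"
    using inv_one one by simp
  have sub: "subgroup {mat 1, - mat 1} SL2C"
    by (rule subgroupI)
       (use m one(1) in \<open>auto simp: mult inv_m inv_1 matrix_mul_minus_mat1\<close>)
  show ?thesis
    by (rule normalI[OF sub])
       (auto simp: r_coset_def l_coset_def SL2C_def matrix_mul_minus_mat1)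
qed

lemma group_PSL2C: "group PSL2C"
  unfolding PSL2C_def by (rule normal.factorgroup_is_group[OF SL2C_center_normal])

lemma PSL2C_disjoint:
  assumes "X \<in> carrier PSL2C" "Y \<in> carrier PSL2C" "A \<in> X" "A \<in> Y"
  shows "X = Y"
proof -
  have "pairwise disjnt (rcosets\<^bsub>SL2C\<^esub> {mat 1, - mat 1})"
    by (rule group.rcos_disjoint[OF group_SL2C normal_imp_subgroup[OF SL2C_center_normal]])
  then show ?thesis
    using assms by (auto simp: PSL2C_def FactGroup_def pairwise_def disjnt_iff)
qed

lemma openin_PSL2C:
  "openin PSL2C_topology U \<longleftrightarrow>
     U \<subseteq> carrier PSL2C \<and> openin (top_of_set (carrier SL2C)) (\<Union>U)"
proof -
  let ?L = "\<lambda>U. U \<subseteq> carrier PSL2C \<and> openin (top_of_set (carrier SL2C)) (\<Union>U)"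
  have "istopology ?L"
    unfolding istopology_def
  proof (intro conjI allI impI)
    fix U V assume U: "?L U" and V: "?L V"
    then show "U \<inter> V \<subseteq> carrier PSL2C"
      by blast
    have "\<Union>(U \<inter> V) = \<Union>U \<inter> \<Union>V"
      using U V PSL2C_disjoint by blast
    then show "openin (top_of_set (carrier SL2C)) (\<Union>(U \<inter> V))"
      using U V by (metis openin_Int)
  next
    fix \<K> assume K: "\<forall>K\<in>\<K>. ?L K"
    then show "\<Union>\<K> \<subseteq> carrier PSL2C"
      by blast
    have "\<Union>(\<Union>\<K>) = \<Union>((\<lambda>K. \<Union>K) ` \<K>)"
      by blast
    moreover have "openin (top_of_set (carrier SL2C)) (\<Union>((\<lambda>K. \<Union>K) ` \<K>))"
      using K by (intro openin_Union) auto
    ultimately show "openin (top_of_set (carrier SL2C)) (\<Union>(\<Union>\<K>))"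
      by simp
  qed
  then show ?thesis
    by (simp add: PSL2C_topology_def topology_inverse')
qed

definition compact_subgroup :: "(complex^2^2) set set \<Rightarrow> bool" where
  "compact_subgroup K \<longleftrightarrow> subgroup K PSL2C \<and> compactin PSL2C_topology K"

definition elliptic :: "(complex^2^2) set \<Rightarrow> bool" where
  "elliptic g \<longleftrightarrow> (\<exists>K. compact_subgroup K \<and> g \<in> K)"

definition upper_triangular_PSL2C :: "(complex^2^2) set set" where
  "upper_triangular_PSL2C = {X \<in> carrier PSL2C. \<forall>A\<in>X. A $ 2 $ 1 = 0}"


section \<open>Representations\<close>

text \<open>Below, \<open>P\<close> is the set of punctures and \<open>x0\<close> the base point.\<close>

type_synonym loop_rep = "(real \<Rightarrow> real^3) set \<Rightarrow> (complex^2^2) set"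

definition representation :: "(real^3) set \<Rightarrow> real^3 \<Rightarrow> loop_rep \<Rightarrow> bool" where
  "representation P x0 \<rho> \<longleftrightarrow> \<rho> \<in> hom (fundamental_group (punctured_sphere P) x0) PSL2C"

definition totally_elliptic :: "(real^3) set \<Rightarrow> real^3 \<Rightarrow> loop_rep \<Rightarrow> bool" where
  "totally_elliptic P x0 \<rho> \<longleftrightarrow>
     (\<forall>\<gamma>\<in>carrier (fundamental_group (punctured_sphere P) x0). \<forall>c.
        simple_closed_curve (punctured_sphere P) c \<and> represents_curve (punctured_sphere P) \<gamma> c
        \<longrightarrow> elliptic (\<rho> \<gamma>))"

definition reduced :: "(real^3) set \<Rightarrow> real^3 \<Rightarrow> loop_rep \<Rightarrow> bool" where
  "reduced P x0 \<rho> \<longleftrightarrow>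
     (\<forall>\<gamma>\<in>carrier (fundamental_group (punctured_sphere P) x0). \<forall>c.
        peripheral_curve P c \<and> represents_curve (punctured_sphere P) \<gamma> c
        \<longrightarrow> \<rho> \<gamma> \<noteq> \<one>\<^bsub>PSL2C\<^esub>)"

definition unitary :: "(real^3) set \<Rightarrow> real^3 \<Rightarrow> loop_rep \<Rightarrow> bool" where
  "unitary P x0 \<rho> \<longleftrightarrow>
     (\<exists>K. compact_subgroup K \<and> \<rho> ` carrier (fundamental_group (punctured_sphere P) x0) \<subseteq> K)"

definition reducible :: "(real^3) set \<Rightarrow> real^3 \<Rightarrow> loop_rep \<Rightarrow> bool" where
  "reducible P x0 \<rho> \<longleftrightarrow>
     (\<exists>g\<in>carrier PSL2C. \<forall>\<gamma>\<in>carrier (fundamental_group (punctured_sphere P) x0).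
        g \<otimes>\<^bsub>PSL2C\<^esub> \<rho> \<gamma> \<otimes>\<^bsub>PSL2C\<^esub> inv\<^bsub>PSL2C\<^esub> g \<in> upper_triangular_PSL2C)"

end

theory Submission
  imports Defs "HOL-Complex_Analysis.Riemann_Mapping"
begin

text \<open>
  Orientation preserving isometries \<open>z \<mapsto> a z + b\<close> of the Euclidean plane,
  \<open>\<bar>a\<bar> = 1\<close>, form a group of upper triangular elements of PSL(2,C). Such
  an isometry is elliptic if \<open>a \<noteq> 1\<close>: it is a rotation about some point. A
  nontrivial translation, on the other hand, is parabolic and lies in no compact subgroup.
  Therefore it suffices to find a representation by Euclidean isometries for which every simple
  closed curve has rotational part different from \<open>1\<close> and some other loop is a
  nontrivial translation.

  The rotational part is a homomorphism to an abelian group. It is chosen such that a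
  counterclockwise loop around any of the \<open>n\<close> punctures is mapped to \<open>exp (2
  * pi * \<i> / n)\<close>; this is compatible with the relation that the product of all these
  loops is trivial. A simple closed curve that is not contractible separates the punctures into
  two nonempty sets. If \<open>k\<close> punctures lie on one side, the rotational part is
  \<open>exp (2 * pi * \<i> * k / n)\<close> or its inverse with \<open>0 < k < n\<close>, which
  is not \<open>1\<close>. This gives total ellipticity, and also reducedness as peripheral
  curves are simple. In the plane obtained by sending one puncture to infinity, the rotational
  part is a sum of winding numbers (\<open>plane_hol_diagonal\<close>), which is
  \<open>k\<close> or \<open>- k\<close> for a simple closed curve
  (\<open>winding_sum_simple_closed_curve\<close>). The topological input is that a simple
  closed curve which encloses no puncture is contractible
  (\<open>simple_closed_curve_null_homotopic\<close>).

  The translational part is chosen such that the loops around two of the punctures are rotations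
  about different points. Their commutator is then a translation, and for \<open>n \<ge>
  3\<close> it is not trivial (\<open>parabolic_loop\<close>).

  As the fundamental group of a punctured plane is free, its generators may be mapped
  arbitrarily. In place of a presentation of this group, the representation is constructed as
  the holonomy of a flat bundle, given by a \<open>local_cocycle\<close>: with the finite
  punctures on the real axis, two trivial bundles over the half planes are glued along the real
  line by elements that change from one puncture-free interval to the next.
\<close>

section \<open>Holonomy of a local cocycle\<close>

lemma locally_constant_on_unit_interval:
  fixes f :: "real \<Rightarrow> 'b"
  assumes "\<And>t. t \<in> {0..1} \<Longrightarrow> \<exists>d>0. \<forall>s\<in>{0..1}. \<bar>s - t\<bar> < d \<longrightarrow> f s = f t"
    and "x \<in> {0..1}" "y \<in> {0..1}"
  shows "f x = f y"
proof -
  have "f constant_on {0..1}"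
  proof (rule locally_constant_imp_constant)
    fix a :: real assume a: "a \<in> {0..1}"
    then obtain d where d: "d > 0" "\<forall>s\<in>{0..1}. \<bar>s - a\<bar> < d \<longrightarrow> f s = f a"
      using assms(1) by blast
    have "\<forall>x\<in>{0..1} \<inter> ball a d. f x = f a"
      using d(2) by (simp add: dist_real_def abs_minus_commute)
    moreover have "openin (top_of_set {0..1}) ({0..1} \<inter> ball a d)"
      by (intro openin_open_Int open_ball)
    moreover have "a \<in> {0..1} \<inter> ball a d"
      using a d(1) by simp
    ultimately show "\<exists>T. openin (top_of_set {0..1}) T \<and> a \<in> T \<and> (\<forall>x\<in>T. f x = f a)"
      by blast
  qed auto
  then show ?thesis
    using assms(2,3) unfolding constant_on_def by metis
qed

text \<open>
  A flat bundle with structure group \<open>G\<close>, described by comparison elements: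
  \<open>T x y\<close> is the parallel transport from \<open>x\<close> to a nearby point
  \<open>y\<close>. Multiplicativity is demanded only on small balls; this is what leaves room
  for holonomy. The values of \<open>T\<close> at distant points are arbitrary; a total function
  avoids the bookkeeping of charts.
\<close>
locale local_cocycle = group G for G (structure) +
  fixes S :: "'a::real_normed_vector set" and T :: "'a \<Rightarrow> 'a \<Rightarrow> 'g"
  assumes T_closed [simp]: "x \<in> S \<Longrightarrow> y \<in> S \<Longrightarrow> T x y \<in> carrier G"
    and T_local: "x \<in> S \<Longrightarrow> \<exists>e>0. \<forall>u\<in>S \<inter> ball x e. \<forall>v\<in>S \<inter> ball x e. \<forall>w\<in>S \<inter> ball x e.
                    T u v \<otimes> T v w = T u w"
begin

lemma T_self: assumes "x \<in> S" shows "T x x = \<one>"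
proof -
  obtain e where "e > 0" "\<forall>u\<in>S \<inter> ball x e. \<forall>v\<in>S \<inter> ball x e. \<forall>w\<in>S \<inter> ball x e.
                    T u v \<otimes> T v w = T u w"
    using T_local assms by blast
  then have "T x x \<otimes> T x x = T x x"
    using assms by simp
  then show ?thesis
    using assms by (metis T_closed l_cancel_one')
qed

text \<open>
  A Lebesgue number for the cover by balls on which \<open>T\<close> is multiplicative.
\<close>
lemma T_uniform:
  assumes "compact K" "K \<subseteq> S"
  obtains e where "e > 0" "\<And>x u v w. x \<in> K \<Longrightarrow> u \<in> S \<inter> ball x e \<Longrightarrow> v \<in> S \<inter> ball x e \<Longrightarrow>
     w \<in> S \<inter> ball x e \<Longrightarrow> T u v \<otimes> T v w = T u w"
proof -
  define good where "good B \<longleftrightarrow> open B \<and> (\<forall>u\<in>S \<inter> B. \<forall>v\<in>S \<inter> B. \<forall>w\<in>S \<inter> B. T u v \<otimes> T v w = T u w)" for B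
  have "K \<subseteq> \<Union>{B. good B}"
  proof
    fix x assume "x \<in> K"
    then obtain e where "e > 0" "good (ball x e)"
      using T_local[of x] assms(2) unfolding good_def by auto
    then show "x \<in> \<Union>{B. good B}"
      by force
  qed
  then obtain e where e: "0 < e" "\<And>x. x \<in> K \<Longrightarrow> \<exists>B \<in> {B. good B}. ball x e \<subseteq> B"
    by (rule Heine_Borel_lemma[OF assms(1)]) (auto simp: good_def)
  show ?thesis
  proof
    fix x u v w
    assume x: "x \<in> K" and uvw: "u \<in> S \<inter> ball x e" "v \<in> S \<inter> ball x e" "w \<in> S \<inter> ball x e"
    obtain B where B: "good B" "ball x e \<subseteq> B"
      using e(2)[OF x] by blast
    show "T u v \<otimes> T v w = T u w"
      using B uvw unfolding good_def by blast
  qed (use e in auto)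
qed

text \<open>
  \<open>h\<close> is parallel along \<open>p\<close>. The comparison is always with the fixed
  point \<open>t\<close>, so that two parallel functions differ by a locally constant factor.
\<close>
definition develops_on :: "real \<Rightarrow> real \<Rightarrow> (real \<Rightarrow> 'a) \<Rightarrow> (real \<Rightarrow> 'g) \<Rightarrow> bool" where
  "develops_on a b p h \<longleftrightarrow> (\<forall>t\<in>{a..b}. h t \<in> carrier G) \<and>
     (\<forall>t\<in>{a..b}. \<exists>d>0. \<forall>s\<in>{a..b}. \<bar>s - t\<bar> < d \<longrightarrow> h s = h t \<otimes> T (p t) (p s))"

lemma develops_on_mult:
  assumes "develops_on a b p h" "g \<in> carrier G" "p ` {a..b} \<subseteq> S"
  shows "develops_on a b p (\<lambda>t. g \<otimes> h t)"
  unfolding develops_on_def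
proof (intro conjI ballI)
  fix t assume t: "t \<in> {a..b}"
  show "g \<otimes> h t \<in> carrier G"
    using assms t by (auto simp: develops_on_def)
  obtain d where d: "d > 0" "\<forall>s\<in>{a..b}. \<bar>s - t\<bar> < d \<longrightarrow> h s = h t \<otimes> T (p t) (p s)"
    using assms(1) t unfolding develops_on_def by blast
  have "g \<otimes> h s = g \<otimes> h t \<otimes> T (p t) (p s)" if s: "s \<in> {a..b}" "\<bar>s - t\<bar> < d" for s
  proof -
    have "h s = h t \<otimes> T (p t) (p s)" using d s by blast
    moreover have "h t \<in> carrier G" "T (p t) (p s) \<in> carrier G"
      using assms s t by (auto simp: develops_on_def intro!: T_closed)
    ultimately show ?thesis
      using assms(2) by (simp add: m_assoc)
  qed
  then show "\<exists>d>0. \<forall>s\<in>{a..b}. \<bar>s - t\<bar> < d \<longrightarrow> g \<otimes> h s = g \<otimes> h t \<otimes> T (p t) (p s)"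
    using d(1) by blast
qed

lemma develops_on_combine:
  assumes hab: "develops_on a b p h" and hbc: "develops_on b c p k" and eq: "h b = k b"
    and ab: "a \<le> b" and bc: "b \<le> c"
  shows "develops_on a c p (\<lambda>t. if t \<le> b then h t else k t)"
  unfolding develops_on_def
proof (intro conjI ballI)
  fix t assume t: "t \<in> {a..c}"
  let ?h = "\<lambda>t. if t \<le> b then h t else k t"
  show "?h t \<in> carrier G"
    using hab hbc t by (auto simp: develops_on_def)
  show "\<exists>d>0. \<forall>s\<in>{a..c}. \<bar>s - t\<bar> < d \<longrightarrow> ?h s = ?h t \<otimes> T (p t) (p s)"
  proof (cases t b rule: linorder_cases)
    case less
    then have "t \<in> {a..b}" using t by simp
    then obtain d where d: "d > 0" "\<forall>s\<in>{a..b}. \<bar>s - t\<bar> < d \<longrightarrow> h s = h t \<otimes> T (p t) (p s)"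
      using hab unfolding develops_on_def by blast
    have "?h s = ?h t \<otimes> T (p t) (p s)" if s: "s \<in> {a..c}" "\<bar>s - t\<bar> < min d (b - t)" for s
    proof -
      have "s \<in> {a..b}" using s by auto
      then have "h s = h t \<otimes> T (p t) (p s)" using d(2) s by simp
      then show ?thesis using \<open>s \<in> {a..b}\<close> less by simp
    qed
    then show ?thesis
      using d(1) less by (intro exI[of _ "min d (b - t)"]) simp
  next
    case greater
    then have "t \<in> {b..c}" using t by simp
    then obtain d where d: "d > 0" "\<forall>s\<in>{b..c}. \<bar>s - t\<bar> < d \<longrightarrow> k s = k t \<otimes> T (p t) (p s)"
      using hbc unfolding develops_on_def by blast
    have "?h s = ?h t \<otimes> T (p t) (p s)" if s: "s \<in> {a..c}" "\<bar>s - t\<bar> < min d (t - b)" for s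
    proof -
      have "s \<in> {b<..c}" using s by auto
      then have "k s = k t \<otimes> T (p t) (p s)" using d(2) s by simp
      then show ?thesis using \<open>s \<in> {b<..c}\<close> greater by simp
    qed
    then show ?thesis
      using d(1) greater by (intro exI[of _ "min d (t - b)"]) simp
  next
    case equal
    have tt: "t \<in> {a..b}" "t \<in> {b..c}" using t equal ab bc by simp_all
    obtain d where d: "d > 0" "\<forall>s\<in>{a..b}. \<bar>s - t\<bar> < d \<longrightarrow> h s = h t \<otimes> T (p t) (p s)"
      using hab tt unfolding develops_on_def by blast
    obtain d' where d': "d' > 0" "\<forall>s\<in>{b..c}. \<bar>s - t\<bar> < d' \<longrightarrow> k s = k t \<otimes> T (p t) (p s)"
      using hbc tt unfolding develops_on_def by blast
    have "?h s = ?h t \<otimes> T (p t) (p s)" if s: "s \<in> {a..c}" "\<bar>s - t\<bar> < min d d'" for s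
    proof (cases "s \<le> b")
      case True
      then have "h s = h t \<otimes> T (p t) (p s)"
        using d(2) s by simp
      then show ?thesis using True equal by simp
    next
      case False
      then have "k s = k t \<otimes> T (p t) (p s)"
        using d'(2) s by simp
      then show ?thesis using False equal eq by simp
    qed
    then show ?thesis
      using d(1) d'(1) by (intro exI[of _ "min d d'"]) simp
  qed
qed

text \<open>
  Being developable passes from two adjacent intervals to their union, after a left translation
  that makes the two developments agree at the common point, and it holds on short intervals
  because \<open>T\<close> itself is a development there. Bisection (Bolzano) does the rest.
\<close>
lemma development_exists:
  assumes "path p" "path_image p \<subseteq> S"
  shows "\<exists>h. develops_on 0 1 p h \<and> h 0 = \<one>"
proof -
  have pS: "p t \<in> S" if "t \<in> {0..1}" for t
    using assms that by (auto simp: path_image_def)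
  have "0 \<le> (0::real) \<and> (1::real) \<le> 1 \<longrightarrow> (\<exists>h. develops_on 0 1 p h)"
  proof (rule Bolzano[where P = "\<lambda>a b. 0 \<le> a \<and> b \<le> 1 \<longrightarrow> (\<exists>h. develops_on a b p h)"])
    fix a b c :: real
    assume 1: "0 \<le> a \<and> b \<le> 1 \<longrightarrow> (\<exists>h. develops_on a b p h)"
      and 2: "0 \<le> b \<and> c \<le> 1 \<longrightarrow> (\<exists>h. develops_on b c p h)" and le: "a \<le> b" "b \<le> c"
    show "0 \<le> a \<and> c \<le> 1 \<longrightarrow> (\<exists>h. develops_on a c p h)"
    proof
      assume ac: "0 \<le> a \<and> c \<le> 1"
      obtain h k where h: "develops_on a b p h" and k: "develops_on b c p k"
        using 1 2 le ac by fastforce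
      have c: "h b \<in> carrier G" "k b \<in> carrier G"
        using h k le by (auto simp: develops_on_def)
      have "develops_on b c p (\<lambda>t. (h b \<otimes> inv (k b)) \<otimes> k t)"
        using c ac le pS by (intro develops_on_mult[OF k]) auto
      moreover have "h b = (h b \<otimes> inv (k b)) \<otimes> k b"
        using c by (simp add: m_assoc)
      ultimately show "\<exists>h. develops_on a c p h"
        using develops_on_combine[OF h] le by blast
    qed
  next
    fix x :: real assume x: "0 \<le> x" "x \<le> 1"
    then obtain e where e: "e > 0" and
      mult: "\<forall>u\<in>S \<inter> ball (p x) e. \<forall>v\<in>S \<inter> ball (p x) e. \<forall>w\<in>S \<inter> ball (p x) e. T u v \<otimes> T v w = T u w"
      using T_local[of "p x"] pS by auto
    obtain d where d: "d > 0" "\<forall>s\<in>{0..1}. dist s x < d \<longrightarrow> dist (p s) (p x) < e"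
      using assms(1) x e unfolding path_def continuous_on_iff by fastforce
    show "\<exists>d>0. \<forall>a b. a \<le> x \<and> x \<le> b \<and> b - a < d \<longrightarrow> 0 \<le> a \<and> b \<le> 1 \<longrightarrow> (\<exists>h. develops_on a b p h)"
    proof (intro exI[of _ d] conjI allI impI)
      fix a b assume ab: "a \<le> x \<and> x \<le> b \<and> b - a < d" "0 \<le> a \<and> b \<le> 1"
      have near: "p t \<in> S \<inter> ball (p x) e" if "t \<in> {a..b}" for t
        using that ab d(2) pS[of t] by (auto simp: dist_commute dist_real_def)
      have "develops_on a b p (\<lambda>t. T (p a) (p t))"
        unfolding develops_on_def
      proof (intro conjI ballI)
        fix t assume t: "t \<in> {a..b}"
        show "T (p a) (p t) \<in> carrier G"
          using near[of a] near[of t] t ab by auto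
        have "T (p a) (p s) = T (p a) (p t) \<otimes> T (p t) (p s)" if "s \<in> {a..b}" for s
        proof -
          have "a \<in> {a..b}" using ab by auto
          then show ?thesis using mult near t that by metis
        qed
        then show "\<exists>d>0. \<forall>s\<in>{a..b}. \<bar>s - t\<bar> < d \<longrightarrow> T (p a) (p s) = T (p a) (p t) \<otimes> T (p t) (p s)"
          using zero_less_one by blast
      qed
      then show "\<exists>h. develops_on a b p h" by blast
    qed (use d in auto)
  qed auto
  then obtain h where h: "develops_on 0 1 p h"
    by auto
  then have h0: "h 0 \<in> carrier G"
    by (auto simp: develops_on_def)
  have "develops_on 0 1 p (\<lambda>t. inv (h 0) \<otimes> h t)"
    using h h0 pS by (intro develops_on_mult) auto
  moreover have "inv (h 0) \<otimes> h 0 = \<one>"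
    using h0 by simp
  ultimately show ?thesis
    by (intro exI[of _ "\<lambda>t. inv (h 0) \<otimes> h t"] conjI)
qed

text \<open>
  The quotient of two developments is locally constant because the transports cancel.
\<close>
lemma development_unique:
  assumes h: "develops_on 0 1 p h" and k: "develops_on 0 1 p k" and eq: "h 0 = k 0"
    and pS: "path_image p \<subseteq> S" and t: "t \<in> {0..1}"
  shows "h t = k t"
proof -
  have pS: "p t \<in> S" if "t \<in> {0..1}" for t
    using pS that by (auto simp: path_image_def)
  have c: "h t \<in> carrier G" "k t \<in> carrier G" if "t \<in> {0..1}" for t
    using h k that by (auto simp: develops_on_def)
  have "h t \<otimes> inv (k t) = h 0 \<otimes> inv (k 0)"
  proof (rule locally_constant_on_unit_interval)
    fix t :: real assume t: "t \<in> {0..1}"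
    obtain d where d: "d > 0" "\<forall>s\<in>{0..1}. \<bar>s - t\<bar> < d \<longrightarrow> h s = h t \<otimes> T (p t) (p s)"
      using h t unfolding develops_on_def by blast
    obtain d' where d': "d' > 0" "\<forall>s\<in>{0..1}. \<bar>s - t\<bar> < d' \<longrightarrow> k s = k t \<otimes> T (p t) (p s)"
      using k t unfolding develops_on_def by blast
    have "h s \<otimes> inv (k s) = h t \<otimes> inv (k t)" if s: "s \<in> {0..1}" "\<bar>s - t\<bar> < min d d'" for s
    proof -
      have hs: "h s = h t \<otimes> T (p t) (p s)" and ks: "k s = k t \<otimes> T (p t) (p s)"
        using d d' s by auto
      have Tc: "T (p t) (p s) \<in> carrier G"
        using pS s t by simp
      have "h s \<otimes> inv (k s) = h t \<otimes> (T (p t) (p s) \<otimes> inv (T (p t) (p s))) \<otimes> inv (k t)"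
        unfolding hs ks using c[OF t] Tc by (simp only: inv_mult_group m_assoc m_closed inv_closed)
      then show ?thesis
        using c t Tc by simp
    qed
    then show "\<exists>d>0. \<forall>s\<in>{0..1}. \<bar>s - t\<bar> < d \<longrightarrow> h s \<otimes> inv (k s) = h t \<otimes> inv (k t)"
      using d(1) d'(1) by (intro exI[of _ "min d d'"]) auto
  qed (use t in auto)
  also have "\<dots> = \<one>"
    using c[of 0] eq by simp
  finally have "h t \<otimes> inv (k t) \<otimes> k t = k t"
    using c[OF t] by simp
  then show ?thesis
    using c[OF t] by (simp add: m_assoc)
qed

definition hol :: "(real \<Rightarrow> 'a) \<Rightarrow> 'g" where
  "hol p = (THE g. \<exists>h. develops_on 0 1 p h \<and> h 0 = \<one> \<and> h 1 = g)"

lemma hol_eq: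
  assumes "develops_on 0 1 p h" "h 0 = \<one>" "path_image p \<subseteq> S"
  shows "hol p = h 1"
  unfolding hol_def
proof (rule the_equality)
  fix g assume "\<exists>h. develops_on 0 1 p h \<and> h 0 = \<one> \<and> h 1 = g"
  then obtain k where k: "develops_on 0 1 p k" "k 0 = \<one>" "k 1 = g" by blast
  then show "g = h 1"
    using development_unique[OF k(1) assms(1)] assms by auto
qed (use assms in blast)

text \<open>
  The common source of the rules for joining and reversing paths: developments are restricted to
  subintervals, or run backwards, by affine maps that do not increase distances.
\<close>
lemma hol_reparametrize:
  assumes h: "develops_on 0 1 p h" and p: "path_image p \<subseteq> S"
    and \<phi>: "\<And>t. t \<in> {0..1} \<Longrightarrow> \<phi> t \<in> {0..1}"
      "\<And>s t. s \<in> {0..1} \<Longrightarrow> t \<in> {0..1} \<Longrightarrow> \<bar>\<phi> s - \<phi> t\<bar> \<le> \<bar>s - t\<bar>"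
    and q: "\<And>t. t \<in> {0..1} \<Longrightarrow> q t = p (\<phi> t)"
  shows "hol q = inv (h (\<phi> 0)) \<otimes> h (\<phi> 1)"
proof -
  have c: "h (\<phi> t) \<in> carrier G" if "t \<in> {0..1}" for t
    using h \<phi>(1) that by (auto simp: develops_on_def)
  have qS: "path_image q \<subseteq> S"
    using p q \<phi>(1) by (auto simp: path_image_def)
  have "develops_on 0 1 q (\<lambda>t. h (\<phi> t))"
    unfolding develops_on_def
  proof (intro conjI ballI)
    fix t :: real assume t: "t \<in> {0..1}"
    then obtain d where d: "d > 0" "\<forall>s\<in>{0..1}. \<bar>s - \<phi> t\<bar> < d \<longrightarrow> h s = h (\<phi> t) \<otimes> T (p (\<phi> t)) (p s)"
      using h \<phi>(1) unfolding develops_on_def by blast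
    have "h (\<phi> s) = h (\<phi> t) \<otimes> T (q t) (q s)" if "s \<in> {0..1}" "\<bar>s - t\<bar> < d" for s
      using d(2) \<phi>(1)[of s] \<phi>(2)[of s t] that q t by auto
    then show "\<exists>d>0. \<forall>s\<in>{0..1}. \<bar>s - t\<bar> < d \<longrightarrow> h (\<phi> s) = h (\<phi> t) \<otimes> T (q t) (q s)"
      using d(1) by blast
  qed (use c in auto)
  then have "develops_on 0 1 q (\<lambda>t. inv (h (\<phi> 0)) \<otimes> h (\<phi> t))"
    using c qS by (intro develops_on_mult) (auto simp: path_image_def)
  then show ?thesis
    using c qS by (subst hol_eq) auto
qed

lemma hol_obtain:
  assumes "path p" "path_image p \<subseteq> S"
  obtains h where "develops_on 0 1 p h" "h 0 = \<one>" "hol p = h 1" 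
  using development_exists[OF assms] hol_eq[OF _ _ assms(2)] by metis

lemma hol_closed: "path p \<Longrightarrow> path_image p \<subseteq> S \<Longrightarrow> hol p \<in> carrier G"
  by (rule hol_obtain) (auto simp: develops_on_def)

lemma hol_cong:
  assumes "path p" "path_image p \<subseteq> S" "\<And>t. t \<in> {0..1} \<Longrightarrow> p t = q t"
  shows "hol p = hol q"
proof -
  obtain h where h: "develops_on 0 1 p h" "h 0 = \<one>" "hol p = h 1"
    using hol_obtain[OF assms(1,2)] .
  have "hol q = inv (h (id 0)) \<otimes> h (id 1)"
    by (rule hol_reparametrize[OF h(1) assms(2)]) (use assms(3) in auto)
  moreover have "h 1 \<in> carrier G"
    using h by (auto simp: develops_on_def)
  ultimately show ?thesis
    using h by simp
qed

lemma hol_join: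
  assumes "path p" "path_image p \<subseteq> S" "path q" "path_image q \<subseteq> S" "pathfinish p = pathstart q"
  shows "hol (p +++ q) = hol p \<otimes> hol q"
proof -
  have pq: "path (p +++ q)" "path_image (p +++ q) \<subseteq> S"
    using assms by (auto simp: path_image_join)
  obtain h where h: "develops_on 0 1 (p +++ q) h" "h 0 = \<one>" "hol (p +++ q) = h 1"
    using hol_obtain[OF pq] .
  have c: "h t \<in> carrier G" if "t \<in> {0..1}" for t
    using h that by (auto simp: develops_on_def)
  have lip: "\<bar>(s + 1) / 2 - (t + 1) / 2\<bar> \<le> \<bar>s - t\<bar>" for s t :: real
    by (simp add: diff_divide_distrib[symmetric])
  have "hol p = inv (h ((\<lambda>t. t / 2) 0)) \<otimes> h ((\<lambda>t. t / 2) 1)"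
    by (rule hol_reparametrize[OF h(1) pq(2)]) (auto simp: joinpaths_def)
  moreover have "hol q = inv (h ((\<lambda>t. (t + 1) / 2) 0)) \<otimes> h ((\<lambda>t. (t + 1) / 2) 1)"
    by (rule hol_reparametrize[OF h(1) pq(2)])
      (use assms(5) lip in \<open>auto simp: joinpaths_def pathfinish_def pathstart_def add_divide_distrib\<close>)
  ultimately show ?thesis
    using h(2,3) c[of "1/2"] c[of 1] by (simp add: m_assoc[symmetric])
qed

lemma hol_reversepath:
  assumes "path p" "path_image p \<subseteq> S"
  shows "hol (reversepath p) = inv (hol p)"
proof -
  obtain h where h: "develops_on 0 1 p h" "h 0 = \<one>" "hol p = h 1"
    using hol_obtain[OF assms] .
  have "hol (reversepath p) = inv (h ((\<lambda>t. 1 - t) 0)) \<otimes> h ((\<lambda>t. 1 - t) 1)"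
    by (rule hol_reparametrize[OF h(1) assms(2)]) (auto simp: reversepath_def)
  moreover have "h 1 \<in> carrier G"
    using h by (auto simp: develops_on_def)
  ultimately show ?thesis
    using h by simp
qed

text \<open>
  Along a path that stays in one chart, the holonomy is the transport between its endpoints.
\<close>
lemma hol_multiplicative_on_image:
  assumes "path_image p \<subseteq> S"
    and "\<And>u v w. u \<in> path_image p \<Longrightarrow> v \<in> path_image p \<Longrightarrow> w \<in> path_image p \<Longrightarrow> T u v \<otimes> T v w = T u w"
  shows "hol p = T (pathstart p) (pathfinish p)"
proof -
  have pim: "p t \<in> path_image p" if "t \<in> {0..1}" for t
    using that by (auto simp: path_image_def)
  then have pS: "p t \<in> S" if "t \<in> {0..1}" for t
    using assms(1) that by blast
  have "develops_on 0 1 p (\<lambda>t. T (p 0) (p t))"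
    unfolding develops_on_def
    using pS pim assms(2) by (auto intro!: exI[of _ 1])
  then show ?thesis
    using pS[of 0] assms(1) by (subst hol_eq) (auto simp: T_self pathstart_def pathfinish_def)
qed

text \<open>
  The holonomy of the intermediate paths of a homotopy is locally constant in the homotopy
  parameter: if \<open>r s\<close> is uniformly close to \<open>r s0\<close>, then a development
  \<open>h\<close> of \<open>r s0\<close> yields the development \<open>h t \<otimes> T (r s0 t)
  (r s t)\<close> of \<open>r s\<close>, and both have the same final value because the
  endpoints are fixed.
\<close>
lemma hol_homotopic:
  assumes "homotopic_paths S p q"
  shows "hol p = hol q"
proof -
  from assms obtain H :: "real \<times> real \<Rightarrow> 'a" where H: "continuous_on ({0..1} \<times> {0..1}) H" "H \<in> ({0..1} \<times> {0..1}) \<rightarrow> S"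
    and H0: "\<forall>x\<in>{0..1}. H (0, x) = p x" and H1: "\<forall>x\<in>{0..1}. H (1, x) = q x"
    and ends: "\<forall>t\<in>{0..1}. pathstart (H \<circ> Pair t) = pathstart p \<and> pathfinish (H \<circ> Pair t) = pathfinish p"
    unfolding homotopic_paths by blast
  define r where "r s = (\<lambda>t. H (s, t))" for s
  have rS: "r s t \<in> S" if "s \<in> {0..1}" "t \<in> {0..1}" for s t
    using H(2) that by (auto simp: r_def)
  have rim: "path_image (r s) \<subseteq> S" if "s \<in> {0..1}" for s
    using rS that by (auto simp: path_image_def)
  have path_r: "path (r s)" if "s \<in> {0..1}" for s
    unfolding path_def r_def
    by (rule continuous_on_compose2[OF H(1)]) (use that in \<open>auto intro!: continuous_intros\<close>)
  have r01: "r s 0 = p 0" "r s 1 = p 1" if "s \<in> {0..1}" for s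
    using ends that by (auto simp: r_def pathstart_def pathfinish_def)
  have unif: "uniformly_continuous_on ({0..1} \<times> {0..1}) H"
    by (intro compact_uniformly_continuous H compact_Times) auto
  have "hol (r 0) = hol (r 1)"
  proof (rule locally_constant_on_unit_interval[where f = "\<lambda>s. hol (r s)"])
    fix s0 :: real assume s0: "s0 \<in> {0..1}"
    obtain e where e: "e > 0" and mult: "\<And>x u v w. x \<in> path_image (r s0) \<Longrightarrow> u \<in> S \<inter> ball x e \<Longrightarrow>
        v \<in> S \<inter> ball x e \<Longrightarrow> w \<in> S \<inter> ball x e \<Longrightarrow> T u v \<otimes> T v w = T u w"
      using T_uniform[OF compact_path_image[OF path_r[OF s0]] rim[OF s0]] by blast
    obtain d where d: "d > 0" and dH: "\<And>z z'. z \<in> {0..1} \<times> {0..1} \<Longrightarrow> z' \<in> {0..1} \<times> {0..1} \<Longrightarrow>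
        dist z' z < d \<Longrightarrow> dist (H z') (H z) < e"
      using unif e unfolding uniformly_continuous_on_def by metis
    have "hol (r s) = hol (r s0)" if s: "s \<in> {0..1}" "\<bar>s - s0\<bar> < d / 2" for s
    proof -
      have near: "r s' t' \<in> S \<inter> ball (r s0 t) e"
        if "s' \<in> {s, s0}" "t \<in> {0..1}" "t' \<in> {0..1}" "\<bar>t' - t\<bar> < d / 2" for s' t t'
      proof -
        have "dist (s', t') (s0, t) \<le> dist s' s0 + dist t' t"
          by (simp add: dist_Pair_Pair sqrt_sum_squares_le_sum)
        also have "\<dots> < d"
          using that s d by (auto simp: dist_real_def)
        finally have "dist (H (s', t')) (H (s0, t)) < e"
          using that s s0 by (intro dH) auto
        then show ?thesis
          using that s s0 rS[of s' t'] by (auto simp: r_def dist_commute)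
      qed
      have im: "r s0 t \<in> path_image (r s0)" if "t \<in> {0..1}" for t
        using that by (auto simp: path_image_def)
      obtain h where h: "develops_on 0 1 (r s0) h" "h 0 = \<one>" "hol (r s0) = h 1"
        using hol_obtain[OF path_r rim] s0 by blast
      have c: "h t \<in> carrier G" if "t \<in> {0..1}" for t
        using h that by (auto simp: develops_on_def)
      define k where "k t = h t \<otimes> T (r s0 t) (r s t)" for t
      have "develops_on 0 1 (r s) k"
        unfolding develops_on_def
      proof (intro conjI ballI)
        fix t :: real assume t: "t \<in> {0..1}"
        show "k t \<in> carrier G"
          unfolding k_def using c t rS s0 s by simp
        obtain d' where d': "d' > 0"
          "\<forall>t'\<in>{0..1}. \<bar>t' - t\<bar> < d' \<longrightarrow> h t' = h t \<otimes> T (r s0 t) (r s0 t')"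
          using h(1) t unfolding develops_on_def by blast
        have "k t' = k t \<otimes> T (r s t) (r s t')" if t': "t' \<in> {0..1}" "\<bar>t' - t\<bar> < min d' (d / 2)" for t'
        proof -
          have n: "r s0 t \<in> S \<inter> ball (r s0 t) e" "r s t \<in> S \<inter> ball (r s0 t) e"
            "r s0 t' \<in> S \<inter> ball (r s0 t) e" "r s t' \<in> S \<inter> ball (r s0 t) e"
            using near[of _ t t] near[of _ t t'] t t' d e by auto
          note m = mult[OF im[OF t]]
          have Tc: "T (r s0 t) (r s0 t') \<in> carrier G" "T (r s0 t') (r s t') \<in> carrier G"
            "T (r s0 t) (r s t) \<in> carrier G" "T (r s t) (r s t') \<in> carrier G"
            using n by auto
          have "k t' = h t \<otimes> (T (r s0 t) (r s0 t') \<otimes> T (r s0 t') (r s t'))"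
            using d'(2) t' c[OF t] Tc by (simp add: k_def m_assoc)
          also have "\<dots> = h t \<otimes> (T (r s0 t) (r s t) \<otimes> T (r s t) (r s t'))"
            using m n by metis
          also have "\<dots> = k t \<otimes> T (r s t) (r s t')"
            using c[OF t] Tc by (simp add: k_def m_assoc)
          finally show ?thesis .
        qed
        then show "\<exists>d>0. \<forall>t'\<in>{0..1}. \<bar>t' - t\<bar> < d \<longrightarrow> k t' = k t \<otimes> T (r s t) (r s t')"
          using d d'(1) by (intro exI[of _ "min d' (d / 2)"]) auto
      qed
      moreover have pS: "p 0 \<in> S" "p 1 \<in> S"
        using rS[OF s0, of 0] rS[OF s0, of 1] r01[OF s0] by auto
      then have "k 0 = \<one>" "k 1 = h 1"
        using r01 s0 s h c[of 1] by (simp_all add: k_def T_self)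
      ultimately show ?thesis
        using hol_eq[OF _ _ rim] s h by metis
    qed
    then show "\<exists>d>0. \<forall>s\<in>{0..1}. \<bar>s - s0\<bar> < d \<longrightarrow> hol (r s) = hol (r s0)"
      using d by (intro exI[of _ "d / 2"]) auto
  qed auto
  moreover have "hol (r 0) = hol p"
    by (rule hol_cong[OF path_r rim]) (use H0 in \<open>simp_all add: r_def\<close>)
  moreover have "hol (r 1) = hol q"
    by (rule hol_cong[OF path_r rim]) (use H1 in \<open>simp_all add: r_def\<close>)
  ultimately show ?thesis by simp
qed

end

context local_cocycle begin

text \<open>
  Holonomy is constant on homotopy classes, so a class can be evaluated at an arbitrary
  representative; the composition with \<open>F\<close> pulls the bundle back along a continuous
  map.
\<close>
lemma hol_compose_class:
  assumes F: "continuous_on S' F" "F ` S' \<subseteq> S" and p: "p \<in> X" and X: "X \<in> carrier (fundamental_group S' x0)"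
  shows "hol (F \<circ> (SOME p. p \<in> X)) = hol (F \<circ> p)"
proof -
  obtain p0 where X: "X = loop_class S' p0"
    using X by (auto simp: fundamental_group_def)
  have "(SOME p. p \<in> X) \<in> X"
    using p by (metis someI)
  then have "homotopic_paths S' (SOME p. p \<in> X) p"
    using p unfolding X loop_class_def by (metis homotopic_paths_sym homotopic_paths_trans mem_Collect_eq)
  then show ?thesis
    using F by (intro hol_homotopic homotopic_paths_continuous_image) auto
qed

lemma hol_compose_hom:
  assumes F: "continuous_on S' F" "F ` S' \<subseteq> S"
  shows "(\<lambda>X. hol (F \<circ> (SOME p. p \<in> X))) \<in> hom (fundamental_group S' x0) G"
proof (rule homI)
  let ?\<Pi> = "fundamental_group S' x0"
  have loop: "path (F \<circ> p)" "path_image (F \<circ> p) \<subseteq> S" if "p \<in> loops_at S' x0" for p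
    using that F by (auto simp: loops_at_def path_image_compose intro!: path_continuous_image elim: continuous_on_subset)
  have val: "hol (F \<circ> (SOME q. q \<in> loop_class S' p)) = hol (F \<circ> p)" if "p \<in> loops_at S' x0" for p
    using that by (intro hol_compose_class[OF F]) (auto simp: loops_at_def loop_class_def fundamental_group_def)
  fix X assume "X \<in> carrier ?\<Pi>"
  then obtain p where p: "X = loop_class S' p" "p \<in> loops_at S' x0"
    by (auto simp: fundamental_group_def)
  then show "hol (F \<circ> (SOME p. p \<in> X)) \<in> carrier G"
    by (simp add: val hol_closed loop)
  fix Y assume "Y \<in> carrier ?\<Pi>"
  then obtain q where q: "Y = loop_class S' q" "q \<in> loops_at S' x0"
    by (auto simp: fundamental_group_def)
  have "hol ((F \<circ> p) +++ (F \<circ> q)) = hol (F \<circ> p) \<otimes> hol (F \<circ> q)"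
    using loop p q by (intro hol_join) (auto simp: pathstart_compose pathfinish_compose loops_at_def)
  then show "hol (F \<circ> (SOME p. p \<in> X \<otimes>\<^bsub>?\<Pi>\<^esub> Y)) = hol (F \<circ> (SOME p. p \<in> X)) \<otimes> hol (F \<circ> (SOME p. p \<in> Y))"
    using p q by (simp add: fundamental_group_mult val loops_at_join path_compose_join)
qed

end

section \<open>Gluing two half planes along the real line\<close>

text \<open>
  The bundle obtained by gluing the trivial bundles over the closed upper and the open lower
  half plane along the real line: descending through the real point \<open>r\<close> multiplies
  by \<open>m r\<close>. The real line itself counts as part of the upper half plane, hence
  \<open>0 \<le> Im x\<close>. Near a real point only one of \<open>Re x\<close> and \<open>Re
  y\<close> needs to be inspected, as \<open>m\<close> is locally constant off the punctures.
\<close>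
definition (in group) cross :: "(real \<Rightarrow> 'a) \<Rightarrow> complex \<Rightarrow> complex \<Rightarrow> 'a" where
  "cross m x y = (if (0 \<le> Im x) = (0 \<le> Im y) then \<one> else if 0 \<le> Im x then m (Re x) else inv (m (Re x)))"

lemma (in group) cross_multiplicative:
  assumes "\<And>r. m r \<in> carrier G" "m (Re u) = m (Re v)" "m (Re v) = m (Re w)"
  shows "cross m u v \<otimes> cross m v w = cross m u w"
  using assms by (auto simp: cross_def)

lemma (in group) local_cocycle_cross:
  fixes Z :: "real set"
  assumes m: "\<And>r. m r \<in> carrier G"
    and const: "\<And>r. r \<notin> Z \<Longrightarrow> \<exists>e>0. \<forall>r'. \<bar>r' - r\<bar> < e \<longrightarrow> m r' = m r"
  shows "local_cocycle G (- complex_of_real ` Z) (cross m)"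
proof
  fix x y show "cross m x y \<in> carrier G"
    using m by (simp add: cross_def)
next
  fix x :: complex assume x: "x \<in> - complex_of_real ` Z"
  show "\<exists>e>0. \<forall>u\<in>- complex_of_real ` Z \<inter> ball x e. \<forall>v\<in>- complex_of_real ` Z \<inter> ball x e.
     \<forall>w\<in>- complex_of_real ` Z \<inter> ball x e. cross m u v \<otimes> cross m v w = cross m u w"
  proof (cases "Im x = 0")
    case True
    then have "Re x \<notin> Z"
      using x by (metis ComplD complex_is_Real_iff image_eqI of_real_Re)
    then obtain e where e: "e > 0" "\<forall>r'. \<bar>r' - Re x\<bar> < e \<longrightarrow> m r' = m (Re x)"
      using const by blast
    have const_x: "m (Re u) = m (Re x)" if "u \<in> ball x e" for u
    proof -
      have "\<bar>Re u - Re x\<bar> \<le> norm (u - x)"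
        using abs_Re_le_cmod[of "u - x"] by simp
      also have "\<dots> < e"
        using that by (simp add: dist_norm norm_minus_commute)
      finally show ?thesis
        using e by blast
    qed
    have "cross m u v \<otimes> cross m v w = cross m u w"
      if "u \<in> ball x e" "v \<in> ball x e" "w \<in> ball x e" for u v w
      using that by (intro cross_multiplicative m) (simp_all only: const_x)
    then show ?thesis
      using e(1) by blast
  next
    case False
    have same_side: "(0 \<le> Im u) = (0 \<le> Im x)" if "u \<in> ball x \<bar>Im x\<bar>" for u
    proof -
      have "\<bar>Im u - Im x\<bar> \<le> norm (u - x)"
        using abs_Im_le_cmod[of "u - x"] by simp
      also have "\<dots> < \<bar>Im x\<bar>"
        using that by (simp add: dist_norm norm_minus_commute)
      finally show ?thesis by linarith
    qed
    have "cross m u v \<otimes> cross m v w = cross m u w"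
      if "u \<in> ball x \<bar>Im x\<bar>" "v \<in> ball x \<bar>Im x\<bar>" "w \<in> ball x \<bar>Im x\<bar>" for u v w
      using same_side[OF that(1)] same_side[OF that(2)] same_side[OF that(3)] by (simp add: cross_def)
    moreover have "\<bar>Im x\<bar> > 0"
      using False by simp
    ultimately show ?thesis
      by blast
  qed
qed

section \<open>Upper triangular unimodular matrices\<close>

text \<open>
  The matrix of the affine map \<open>z \<mapsto> l\<^sup>2 z + l m\<close>.
\<close>
definition ut :: "complex \<Rightarrow> complex \<Rightarrow> complex^2^2" where
  "ut l m = vector [vector [l, m], vector [0, inverse l]]"

lemma ut_nth [simp]: "ut l m $ 1 $ 1 = l" "ut l m $ 1 $ 2 = m" "ut l m $ 2 $ 1 = 0" "ut l m $ 2 $ 2 = inverse l"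
  by (simp_all add: ut_def)

lemma ut_eq_iff [simp]: "ut l m = ut l' m' \<longleftrightarrow> l = l' \<and> m = m'"
  by (auto simp: vec_eq_iff forall_2)

lemma ut_mult: "ut l m ** ut l' m' = ut (l * l') (l * m' + m * inverse l')"
  by (simp add: vec_eq_iff forall_2 matrix_matrix_mult_def sum_2)

lemma ut_one: "ut 1 0 = mat 1"
  by (simp add: vec_eq_iff forall_2 mat_def)

lemma det_ut: "l \<noteq> 0 \<Longrightarrow> det (ut l m) = 1"
  by (simp add: det_2)

text \<open>
  The matrices whose affine map is a Euclidean isometry of \<open>\<complex>\<close>: a rotation
  if \<open>l\<^sup>2 \<noteq> 1\<close>, and a translation otherwise.
\<close>
definition UT :: "(complex^2^2) monoid" where
  "UT = \<lparr>carrier = {ut l m |l m. norm l = 1}, mult = (**), one = mat 1\<rparr>"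

lemma UT_simps [simp]: "x \<otimes>\<^bsub>UT\<^esub> y = x ** y" "\<one>\<^bsub>UT\<^esub> = mat 1"
  by (simp_all add: UT_def)

lemma ut_in_UT [simp]: "ut l m \<in> carrier UT \<longleftrightarrow> norm l = 1"
  by (auto simp: UT_def)

lemma UT_cases: assumes "A \<in> carrier UT" obtains l m where "A = ut l m" "norm l = 1" "l \<noteq> 0"
  using assms by (force simp: UT_def)

lemma group_UT: "group UT"
proof (rule groupI)
  fix A assume "A \<in> carrier UT"
  then obtain l m where A: "A = ut l m" "norm l = 1" "l \<noteq> 0"
    by (rule UT_cases)
  then have "ut (inverse l) (- m) ** A = mat 1" "ut (inverse l) (- m) \<in> carrier UT"
    by (auto simp: ut_mult norm_inverse ut_one[symmetric])
  then show "\<exists>B\<in>carrier UT. B \<otimes>\<^bsub>UT\<^esub> A = \<one>\<^bsub>UT\<^esub>"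
    by auto
qed (auto simp: UT_def ut_mult norm_mult matrix_mul_assoc ut_one[symmetric])

interpretation UT: group UT by (rule group_UT)

lemma inv_ut: assumes "norm l = 1" shows "inv\<^bsub>UT\<^esub> (ut l m) = ut (inverse l) (- m)"
proof -
  have "l \<noteq> 0" using assms by auto
  then show ?thesis
    using assms by (intro UT.inv_equality) (auto simp: ut_mult norm_inverse ut_one[symmetric])
qed

lemma UT_hom_SL2C: "(\<lambda>A. A) \<in> hom UT SL2C"
  by (rule homI) (auto simp: SL2C_def det_ut elim!: UT_cases simp del: ut_in_UT)

section \<open>Crossings and winding numbers\<close>

text \<open>
  The signed number of crossings of the half line to the left of \<open>z\<close> on the way
  from \<open>x\<close> to a nearby point \<open>y\<close>. Crossings downwards are positive,
  being counterclockwise around \<open>z\<close>.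
\<close>
definition crossing_number :: "real \<Rightarrow> complex \<Rightarrow> complex \<Rightarrow> int" where
  "crossing_number z x y =
     (if (0 \<le> Im x) = (0 \<le> Im y) \<or> z < Re x then 0 else if 0 \<le> Im x then 1 else -1)"

lemma continuous_integer_valued_locally_constant:
  fixes f :: "real \<Rightarrow> complex"
  assumes f: "continuous (at t within A) f" and int: "\<forall>\<^sub>F s in at t within A. f s \<in> \<int>" "f t \<in> \<int>"
  shows "\<forall>\<^sub>F s in at t within A. f s = f t"
proof -
  have "\<forall>\<^sub>F s in at t within A. dist (f s) (f t) < 1"
    using f unfolding continuous_within by (rule tendstoD) simp
  then show ?thesis
    using int(1)
  proof eventually_elim
    case (elim s)
    obtain a b :: int where "f s = of_int a" "f t = of_int b"
      using elim int by (auto elim!: Ints_cases)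
    then show ?case
      using elim by (simp add: dist_norm flip: of_int_diff) 
  qed
qed

text \<open>
  Along a path, a continuous logarithm \<open>q\<close> of \<open>p - z\<close> and the
  principal logarithm differ by an integral multiple of \<open>2 * pi * \<i>\<close>. This
  integer is locally constant except where the path meets the branch cut to the left of
  \<open>z\<close>, and there it changes by the crossing number. Hence the total of the
  crossings of a loop is its winding number.
\<close>
lemma log_deficit_crossing:
  fixes p q :: "real \<Rightarrow> complex" and z :: real
  defines "\<kappa> \<equiv> \<lambda>t. (q t - Ln (p t - z)) / (2 * pi * \<i>)"
  assumes p: "path p" and q: "path q" and pq: "\<And>t. t \<in> {0..1} \<Longrightarrow> p t = z + exp (q t)"
    and t: "t \<in> {0..1}"
  shows "\<forall>\<^sub>F s in at t within {0..1}. \<kappa> s = \<kappa> t + of_int (crossing_number z (p t) (p s))"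
proof -
  have cp: "continuous (at t within {0..1}) p" and cq: "continuous (at t within {0..1}) q"
    using p q t by (auto simp: path_def continuous_on_eq_continuous_within)
  have evt: "\<forall>\<^sub>F s in at t within {0..1}. s \<in> {0..1}"
    by (simp add: eventually_at_filter)
  have log_int: "(q s - w) / (2 * pi * \<i>) \<in> \<int>" if "s \<in> {0..1}" "exp w = p s - z" for s w
  proof -
    have "exp (q s) = exp w"
      using pq that by simp
    then obtain n :: int where "q s = w + (of_int (2 * n) * pi) * \<i>"
      by (auto simp: exp_eq)
    then have "(q s - w) / (2 * pi * \<i>) = of_int n"
      by (simp add: field_simps)
    then show ?thesis by simp
  qed
  have nz: "p s - z \<noteq> 0" if "s \<in> {0..1}" for s
    using pq that by simp
  show ?thesis
  proof (cases "p t - z \<in> \<real>\<^sub>\<le>\<^sub>0")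
    case False
    have "continuous (at t within {0..1}) \<kappa>"
      unfolding \<kappa>_def using False by (intro continuous_intros cp cq continuous_within_compose3[OF continuous_at_Ln]) auto
    moreover have "\<kappa> s \<in> \<int>" if "s \<in> {0..1}" for s
      unfolding \<kappa>_def using that nz by (intro log_int) auto
    ultimately have "\<forall>\<^sub>F s in at t within {0..1}. \<kappa> s = \<kappa> t"
      using t evt by (intro continuous_integer_valued_locally_constant) (auto elim: eventually_mono)
    moreover have "\<forall>\<^sub>F s in at t within {0..1}. crossing_number z (p t) (p s) = 0"
    proof (cases "Im (p t) = 0")
      case True
      then have "z < Re (p t)"
        using False by (auto simp: complex_nonpos_Reals_iff)
      then show ?thesis by (simp add: crossing_number_def)
    next
      case im: False
      have lim: "((\<lambda>s. Im (p s)) \<longlongrightarrow> Im (p t)) (at t within {0..1})"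
        using cp unfolding continuous_within by (intro tendsto_intros)
      have "\<forall>\<^sub>F s in at t within {0..1}. (0 \<le> Im (p s)) = (0 \<le> Im (p t))"
      proof (cases "Im (p t) > 0")
        case True
        then show ?thesis
          using order_tendstoD(1)[OF lim True] by (auto elim: eventually_mono)
      next
        case False
        then have "Im (p t) < 0" using im by simp
        then show ?thesis
          using order_tendstoD(2)[OF lim \<open>Im (p t) < 0\<close>] by (auto elim: eventually_mono)
      qed
      then show ?thesis
        by eventually_elim (simp add: crossing_number_def)
    qed
    ultimately show ?thesis
      by eventually_elim simp
  next
    case True
    then have im: "Im (p t) = 0" and re: "Re (p t) < z"
      using nz[OF t] by (auto simp: complex_nonpos_Reals_iff complex_eq_iff)
    \<comment> \<open>On the cut, the logarithm of \<open>z - p\<close> is continuous and serves as a comparison.\<close>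
    define \<mu> where "\<mu> s = (q s - (Ln (z - p s) + pi * \<i>)) / (2 * pi * \<i>)" for s
    have \<kappa>\<mu>: "\<kappa> s = \<mu> s + (if 0 \<le> Im (p s) then 0 else 1)" if "s \<in> {0..1}" "Re (p s) < z" for s
    proof -
      have "Ln (p s - z) = Ln (- (z - p s))" by simp
      also have "\<dots> = (if 0 \<le> Im (p s) then Ln (z - p s) + \<i> * pi else Ln (z - p s) - \<i> * pi)"
        using that nz[OF that(1)] by (subst Ln_minus) auto
      finally show ?thesis
        by (simp add: \<kappa>_def \<mu>_def field_simps)
    qed
    have "continuous (at t within {0..1}) \<mu>"
      unfolding \<mu>_def using im re
      by (intro continuous_intros cp cq continuous_within_compose3[OF continuous_at_Ln]) (auto simp: complex_nonpos_Reals_iff)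
    moreover have "\<mu> s \<in> \<int>" if "s \<in> {0..1}" for s
      unfolding \<mu>_def using that nz[OF that] by (intro log_int) (auto simp: exp_add)
    ultimately have "\<forall>\<^sub>F s in at t within {0..1}. \<mu> s = \<mu> t"
      using t evt by (intro continuous_integer_valued_locally_constant) (auto elim: eventually_mono)
    moreover have "((\<lambda>s. Re (p s)) \<longlongrightarrow> Re (p t)) (at t within {0..1})"
      using cp unfolding continuous_within by (intro tendsto_intros)
    then have "\<forall>\<^sub>F s in at t within {0..1}. Re (p s) < z"
      using re by (rule order_tendstoD(2))
    ultimately show ?thesis
      using evt
    proof eventually_elim
      case (elim s)
      then show ?case
        using \<kappa>\<mu>[of s] \<kappa>\<mu>[OF t re] im re by (simp add: crossing_number_def)
    qed
  qed
qed

section \<open>A twisted gluing\<close>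

definition punctures_from :: "nat \<Rightarrow> real \<Rightarrow> nat set" where
  "punctures_from n r = {j \<in> {1..<n}. r \<le> real j}"

text \<open>
  The gluing element for the real point \<open>r\<close>. The diagonal part is the rotation by
  \<open>2 * pi / n\<close> about the origin, once for each puncture to the right of
  \<open>r\<close>, so that a small counterclockwise loop around any puncture has a rotation by
  \<open>2 * pi / n\<close> as its holonomy. The additional translation on the single interval
  between the punctures \<open>1\<close> and \<open>2\<close> gives the loops around these two
  punctures different fixed points.
\<close>
definition twist :: "nat \<Rightarrow> real \<Rightarrow> complex^2^2" where
  "twist n r = (let l = exp (pi * \<i> / n) ^ card (punctures_from n r)
                in ut l (if 1 < r \<and> r < 2 then inverse l else 0))"

definition punctured_plane :: "nat \<Rightarrow> complex set" where
  "punctured_plane n = - complex_of_real ` real ` {1..<n}"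

lemma norm_exp_pi_root: "norm (exp (pi * \<i> / of_nat n) ^ k) = 1"
  by (simp add: norm_power)

lemma twist_closed: "twist n r \<in> carrier UT"
  using norm_exp_pi_root by (simp add: twist_def Let_def)

lemma twist_locally_constant:
  assumes n: "n \<ge> 3" and r: "r \<notin> real ` {1..<n}"
  shows "\<exists>e>0. \<forall>r'. \<bar>r' - r\<bar> < e \<longrightarrow> twist n r' = twist n r"
proof -
  have "open (- real ` {1..<n})"
    by (intro open_Compl finite_imp_closed) auto
  then obtain e where e: "e > 0" "ball r e \<subseteq> - real ` {1..<n}"
    using r by (metis ComplI openE)
  have "twist n r' = twist n r" if r': "\<bar>r' - r\<bar> < e" for r'
  proof -
    have side: "r' \<le> real j \<longleftrightarrow> r \<le> real j" "r' < real j \<longleftrightarrow> r < real j" if j: "j \<in> {1..<n}" for j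
    proof -
      have "real j \<notin> ball r e"
        using e(2) j by auto
      then show "r' \<le> real j \<longleftrightarrow> r \<le> real j" "r' < real j \<longleftrightarrow> r < real j"
        using r' by (auto simp: dist_real_def)
    qed
    then have "punctures_from n r' = punctures_from n r"
      by (auto simp: punctures_from_def)
    moreover have "(1 < r' \<and> r' < 2) = (1 < r \<and> r < 2)"
      using side[of 1] side[of 2] n by auto
    ultimately show ?thesis
      by (simp add: twist_def)
  qed
  then show ?thesis
    using e(1) by blast
qed

lemma local_cocycle_twist:
  assumes "n \<ge> 3"
  shows "local_cocycle UT (punctured_plane n) (UT.cross (twist n))"
  unfolding punctured_plane_def
  using twist_closed twist_locally_constant[OF assms] by (rule UT.local_cocycle_cross)

definition plane_hol :: "nat \<Rightarrow> (real \<Rightarrow> complex) \<Rightarrow> complex^2^2" where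
  "plane_hol n = local_cocycle.hol UT (UT.cross (twist n))"

text \<open>
  On the diagonal, the upper triangular group becomes abelian and the gluing only counts
  crossings.
\<close>
lemma cross_twist_diagonal:
  "UT.cross (twist n) x y $ 1 $ 1 =
     exp (pi * \<i> / n * of_int (\<Sum>j\<in>{1..<n}. crossing_number (real j) x y))"
proof (cases "(0 \<le> Im x) = (0 \<le> Im y)")
  case True
  then show ?thesis
    by (simp add: UT.cross_def crossing_number_def mat_def)
next
  case False
  let ?N = "card (punctures_from n (Re x))" and ?e = "exp (pi * \<i> / n)"
  have "(\<Sum>j\<in>{1..<n}. if real j < Re x then 0 else c) = (\<Sum>j\<in>punctures_from n (Re x). c)" for c :: int
    unfolding punctures_from_def by (rule sum.mono_neutral_cong_right) auto
  then have card: "(\<Sum>j\<in>{1..<n}. if real j < Re x then 0 else c) = int ?N * c" for c :: int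
    by simp
  have *: "exp (pi * \<i> / n * of_int (int ?N)) = ?e ^ ?N"
    by (simp add: exp_of_nat_mult[symmetric] mult.commute)
  show ?thesis
  proof (cases "0 \<le> Im x")
    case True
    then have "(\<Sum>j\<in>{1..<n}. crossing_number (real j) x y) = int ?N * 1"
      using False by (subst card[symmetric]) (auto simp: crossing_number_def intro!: sum.cong)
    then show ?thesis
      using True False * by (simp add: UT.cross_def twist_def Let_def)
  next
    case im: False
    then have sum: "(\<Sum>j\<in>{1..<n}. crossing_number (real j) x y) = int ?N * (-1)"
      using False by (subst card[symmetric]) (auto simp: crossing_number_def intro!: sum.cong)
    have "exp (pi * \<i> / n * of_int (int ?N * (-1))) = inverse (?e ^ ?N)"
      using * by (simp add: exp_minus)
    then show ?thesis
      unfolding sum using im False norm_exp_pi_root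
      by (simp add: UT.cross_def twist_def Let_def inv_ut)
  qed
qed

text \<open>
  With \<open>\<kappa> j t\<close> the integer by which the continuous logarithm of \<open>p -
  j\<close> leads the principal one, the diagonal entry of a development changes exactly like
  \<open>exp (pi * \<i> / n * (\<Sum>j. \<kappa> j t))\<close>, because both are driven by the
  crossings. Over a loop, \<open>\<kappa> j\<close> grows by the winding number around
  \<open>j\<close>.
\<close>
lemma plane_hol_diagonal:
  assumes n: "n \<ge> 3" and p: "path p" "path_image p \<subseteq> punctured_plane n" "pathfinish p = pathstart p"
  shows "plane_hol n p $ 1 $ 1 = exp (pi * \<i> / n * (\<Sum>j\<in>{1..<n}. winding_number p (of_nat j)))"
proof -
  interpret T: local_cocycle UT "punctured_plane n" "UT.cross (twist n)"
    by (rule local_cocycle_twist[OF n])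
  have "\<forall>j\<in>{1..<n}. \<exists>q :: real \<Rightarrow> complex. path q \<and> pathfinish q - pathstart q = 2 * of_real pi * \<i> * winding_number p (real j)
     \<and> (\<forall>t\<in>{0..1}. p t = real j + exp (q t))"
  proof
    fix j assume "j \<in> {1..<n}"
    then have "complex_of_real (real j) \<notin> path_image p"
      using p(2) imageI[OF imageI[of j "{1..<n}" real], of complex_of_real]
      unfolding punctured_plane_def by blast
    then show "\<exists>q :: real \<Rightarrow> complex. path q \<and> pathfinish q - pathstart q = 2 * of_real pi * \<i> * winding_number p (real j)
       \<and> (\<forall>t\<in>{0..1}. p t = real j + exp (q t))"
      by (rule winding_number_as_continuous_log[OF p(1)]) blast
  qed
  then obtain q :: "nat \<Rightarrow> real \<Rightarrow> complex" where q: "\<And>j. j \<in> {1..<n} \<Longrightarrow> path (q j)"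
    "\<And>j. j \<in> {1..<n} \<Longrightarrow> q j 1 - q j 0 = 2 * of_real pi * \<i> * winding_number p (real j)"
    "\<And>j t. j \<in> {1..<n} \<Longrightarrow> t \<in> {0..1} \<Longrightarrow> p t = real j + exp (q j t)"
    unfolding pathfinish_def pathstart_def by metis
  define \<kappa> where "\<kappa> j t = (q j t - Ln (p t - real j)) / (2 * pi * \<i>)" for j t
  define c where "c = complex_of_real pi * \<i> / of_nat n"
  define Y where "Y t = exp (c * (\<Sum>j\<in>{1..<n}. \<kappa> j t))" for t
  obtain h where h: "T.develops_on 0 1 p h" "h 0 = mat 1" "plane_hol n p = h 1"
    using T.hol_obtain[OF p(1,2)] unfolding plane_hol_def by auto
  have "h 1 $ 1 $ 1 / Y 1 = h 0 $ 1 $ 1 / Y 0"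
  proof (rule locally_constant_on_unit_interval[where f = "\<lambda>t. h t $ 1 $ 1 / Y t"])
    fix t :: real assume t: "t \<in> {0..1}"
    have "\<forall>\<^sub>F s in at t within {0..1}. \<forall>j\<in>{1..<n}.
        \<kappa> j s = \<kappa> j t + of_int (crossing_number (real j) (p t) (p s))"
      unfolding \<kappa>_def
      by (intro eventually_ball_finite ballI log_deficit_crossing p q t) auto
    then obtain d where d: "d > 0" "\<And>s j. s \<in> {0..1} \<Longrightarrow> s \<noteq> t \<Longrightarrow> \<bar>s - t\<bar> < d \<Longrightarrow> j \<in> {1..<n} \<Longrightarrow>
        \<kappa> j s = \<kappa> j t + of_int (crossing_number (real j) (p t) (p s))"
      unfolding eventually_at dist_real_def by metis
    obtain d' where d': "d' > 0" "\<And>s. s \<in> {0..1} \<Longrightarrow> \<bar>s - t\<bar> < d' \<Longrightarrow>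
        h s = h t ** UT.cross (twist n) (p t) (p s)"
      using h(1) t unfolding T.develops_on_def UT_simps by metis
    have "h s $ 1 $ 1 / Y s = h t $ 1 $ 1 / Y t" if s: "s \<in> {0..1}" "\<bar>s - t\<bar> < min d d'" for s
    proof (cases "s = t")
      case False
      have "Y s = exp (c * (\<Sum>j\<in>{1..<n}. \<kappa> j t + of_int (crossing_number (real j) (p t) (p s))))"
        unfolding Y_def using d(2)[of s] s False by simp
      also have "\<dots> = Y t * UT.cross (twist n) (p t) (p s) $ 1 $ 1"
        unfolding cross_twist_diagonal Y_def c_def
        by (simp add: sum.distrib algebra_simps exp_add add_divide_distrib)
      finally have Ys: "Y s = Y t * UT.cross (twist n) (p t) (p s) $ 1 $ 1" .
      have "h t \<in> carrier UT"
        using h(1) t by (auto simp: T.develops_on_def)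
      moreover have "UT.cross (twist n) (p t) (p s) \<in> carrier UT"
        using twist_closed UT.one_closed by (simp add: UT.cross_def)
      ultimately have "(h t ** UT.cross (twist n) (p t) (p s)) $ 1 $ 1
          = h t $ 1 $ 1 * UT.cross (twist n) (p t) (p s) $ 1 $ 1"
        by (auto elim!: UT_cases simp: ut_mult simp del: ut_in_UT)
      then show ?thesis
        using d'(2)[of s] s Ys by (simp add: cross_twist_diagonal)
    qed simp
    then show "\<exists>d>0. \<forall>s\<in>{0..1}. \<bar>s - t\<bar> < d \<longrightarrow> h s $ 1 $ 1 / Y s = h t $ 1 $ 1 / Y t"
      using d(1) d'(1) by (intro exI[of _ "min d d'"]) simp
  qed auto
  then have "h 1 $ 1 $ 1 = Y 1 / Y 0"
    using h(2) by (simp add: Y_def mat_def divide_eq_eq)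
  also have "\<dots> = exp (c * (\<Sum>j\<in>{1..<n}. \<kappa> j 1 - \<kappa> j 0))"
    by (simp add: Y_def exp_diff[symmetric] sum_subtractf right_diff_distrib)
  also have "(\<Sum>j\<in>{1..<n}. \<kappa> j 1 - \<kappa> j 0) = (\<Sum>j\<in>{1..<n}. winding_number p (of_nat j))"
  proof (rule sum.cong[OF refl])
    fix j assume j: "j \<in> {1..<n}"
    have "\<kappa> j 1 - \<kappa> j 0 = (q j 1 - q j 0) / (2 * pi * \<i>)"
      using p(3) by (simp add: \<kappa>_def pathfinish_def pathstart_def diff_divide_distrib[symmetric])
    then show "\<kappa> j 1 - \<kappa> j 0 = winding_number p (of_nat j)"
      using q(2)[OF j] by simp
  qed
  finally show ?thesis
    using h(3) by (simp add: c_def)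
qed

section \<open>A loop with parabolic holonomy\<close>

text \<open>
  A path from \<open>\<i>\<close> to \<open>- \<i>\<close> that crosses the real line only at
  \<open>r\<close>. Its holonomy is the gluing element at \<open>r\<close>, and two such paths
  on both sides of a puncture form a loop around it.
\<close>
definition descent :: "real \<Rightarrow> real \<Rightarrow> complex" where
  "descent r = (linepath \<i> (Complex r 1) +++ linepath (Complex r 1) (Complex r (-1)))
                 +++ linepath (Complex r (-1)) (- \<i>)"

lemma descent_path: "path (descent r)" "pathstart (descent r) = \<i>" "pathfinish (descent r) = - \<i>"
  by (simp_all add: descent_def)

lemma linepath_coordinates:
  assumes "x \<in> path_image (linepath a b)"
  shows "Re x \<in> closed_segment (Re a) (Re b) \<and> Im x \<in> closed_segment (Im a) (Im b)"
  using assms by (auto simp: closed_segment_def)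

lemma descent_pieces:
  assumes "r \<notin> real ` {1..<n}"
  shows "path_image (linepath \<i> (Complex r 1)) \<subseteq> punctured_plane n"
    "path_image (linepath (Complex r 1) (Complex r (-1))) \<subseteq> punctured_plane n"
    "path_image (linepath (Complex r (-1)) (- \<i>)) \<subseteq> punctured_plane n"
proof -
  have "Im x \<noteq> 0 \<or> Re x \<notin> real ` {1..<n} \<Longrightarrow> x \<in> punctured_plane n" for x
    by (auto simp: punctured_plane_def)
  then show "path_image (linepath \<i> (Complex r 1)) \<subseteq> punctured_plane n"
    "path_image (linepath (Complex r 1) (Complex r (-1))) \<subseteq> punctured_plane n"
    "path_image (linepath (Complex r (-1)) (- \<i>)) \<subseteq> punctured_plane n"
    using assms by (auto simp del: path_image_linepath dest!: linepath_coordinates)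
qed

lemma descent_image:
  assumes "r \<notin> real ` {1..<n}"
  shows "path_image (descent r) \<subseteq> punctured_plane n"
  using descent_pieces[OF assms] by (simp add: descent_def path_image_join)

lemma plane_hol_descent:
  assumes n: "n \<ge> 3" and r: "r \<notin> real ` {1..<n}"
  shows "plane_hol n (descent r) = twist n r"
proof -
  interpret T: local_cocycle UT "punctured_plane n" "UT.cross (twist n)"
    by (rule local_cocycle_twist[OF n])
  note pc = descent_pieces[OF r]
  have 1: "T.hol (linepath \<i> (Complex r 1)) = mat 1"
    by (subst T.hol_multiplicative_on_image[OF pc(1)])
      (auto simp: UT.cross_def simp del: path_image_linepath dest!: linepath_coordinates)
  have 2: "T.hol (linepath (Complex r 1) (Complex r (-1))) = twist n r"
  proof (subst T.hol_multiplicative_on_image[OF pc(2)])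
    fix u v w assume *: "u \<in> path_image (linepath (Complex r 1) (Complex r (-1)))"
      "v \<in> path_image (linepath (Complex r 1) (Complex r (-1)))"
      "w \<in> path_image (linepath (Complex r 1) (Complex r (-1)))"
    have "Re u = r" "Re v = r" "Re w = r"
      using *[THEN linepath_coordinates] by simp_all
    then show "UT.cross (twist n) u v \<otimes>\<^bsub>UT\<^esub> UT.cross (twist n) v w = UT.cross (twist n) u w"
      by (intro UT.cross_multiplicative twist_closed) simp_all
  qed (simp add: UT.cross_def)
  have 3: "T.hol (linepath (Complex r (-1)) (- \<i>)) = mat 1"
    by (subst T.hol_multiplicative_on_image[OF pc(3)])
      (auto simp: UT.cross_def simp del: path_image_linepath dest!: linepath_coordinates)
  show ?thesis
    unfolding plane_hol_def descent_def
    using pc by (simp add: T.hol_join path_image_join 1 2 3 del: path_image_linepath)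
qed

text \<open>
  The loops \<open>\<alpha>\<close> and \<open>\<beta>\<close> encircle the punctures
  \<open>1\<close> and \<open>2\<close>. Their holonomies are rotations with the same angle
  about different points; so the commutator, whose rotational part cancels, is a translation,
  namely by \<open>1 - \<eta>\<^sup>4\<close>, where \<open>\<eta>\<^sup>4\<close> is the square
  of the rotational part \<open>\<eta>\<^sup>2 = exp (2 * pi * \<i> / n)\<close> of both. It
  differs from zero because \<open>n\<close> does not divide \<open>2\<close>.
\<close>
lemma parabolic_loop:
  assumes n: "n \<ge> 3"
  obtains \<gamma> s where "path \<gamma>" "path_image \<gamma> \<subseteq> punctured_plane n" "pathstart \<gamma> = \<i>" "pathfinish \<gamma> = \<i>"
    "plane_hol n \<gamma> = ut 1 s" "s \<noteq> 0"
proof -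
  interpret T: local_cocycle UT "punctured_plane n" "UT.cross (twist n)"
    by (rule local_cocycle_twist[OF n])
  have half: "real k + 1 / 2 \<notin> real ` {1..<n}" for k
  proof
    assume "real k + 1 / 2 \<in> real ` {1..<n}"
    then obtain j where "real k + 1 / 2 = real j" by blast
    then have "real (2 * k + 1) = real (2 * j)" by simp
    then have "2 * k + 1 = 2 * j" using of_nat_eq_iff by blast
    then show False by presburger
  qed
  define \<sigma> where "\<sigma> k = descent (real k + 1 / 2)" for k
  define g where "g k = twist n (real k + 1 / 2)" for k
  have \<sigma>: "path (\<sigma> k)" "path_image (\<sigma> k) \<subseteq> punctured_plane n" "pathstart (\<sigma> k) = \<i>"
    "pathfinish (\<sigma> k) = - \<i>" "T.hol (\<sigma> k) = g k" for k
    using descent_path descent_image[OF half] plane_hol_descent[OF n half]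
    by (simp_all add: \<sigma>_def g_def plane_hol_def)
  define \<alpha> where "\<alpha> = \<sigma> 0 +++ reversepath (\<sigma> 1)"
  define \<beta> where "\<beta> = \<sigma> 1 +++ reversepath (\<sigma> 2)"
  have \<alpha>: "path \<alpha>" "path_image \<alpha> \<subseteq> punctured_plane n" "pathstart \<alpha> = \<i>" "pathfinish \<alpha> = \<i>"
    "T.hol \<alpha> = g 0 ** inv\<^bsub>UT\<^esub> (g 1)"
    using \<sigma> by (simp_all add: \<alpha>_def path_image_join T.hol_join T.hol_reversepath)
  have \<beta>: "path \<beta>" "path_image \<beta> \<subseteq> punctured_plane n" "pathstart \<beta> = \<i>" "pathfinish \<beta> = \<i>"
    "T.hol \<beta> = g 1 ** inv\<^bsub>UT\<^esub> (g 2)"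
    using \<sigma> by (simp_all add: \<beta>_def path_image_join T.hol_join T.hol_reversepath)
  define \<eta> where "\<eta> = exp (pi * \<i> / n)"
  have \<eta>: "norm \<eta> = 1" "\<eta> \<noteq> 0"
    by (simp_all add: \<eta>_def)
  define E where "E = \<eta> ^ (n - 2)"
  have E: "norm E = 1" "E \<noteq> 0"
    using \<eta> by (simp_all add: E_def norm_power)
  have card: "card (punctures_from n (real k + 1 / 2)) = n - 1 - k" for k
  proof -
    have "punctures_from n (real k + 1 / 2) = {Suc k..<n}"
      by (auto simp: punctures_from_def)
    then show ?thesis by simp
  qed
  have pow: "\<eta> ^ (n - 1) = \<eta> * E" "\<eta> ^ (n - 3) = E / \<eta>"
  proof -
    obtain k where "n = k + 3"
      using n by (metis add.commute le_Suc_ex)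
    then show "\<eta> ^ (n - 1) = \<eta> * E" "\<eta> ^ (n - 3) = E / \<eta>"
      using \<eta> by (simp_all add: E_def numeral_eq_Suc)
  qed
  have g: "g 0 = ut (\<eta> * E) 0" "g 1 = ut E (inverse E)" "g 2 = ut (E / \<eta>) 0"
    using pow card[of 0] card[of 1] card[of 2]
    by (simp_all add: numeral_2_eq_2 numeral_3_eq_3 g_def twist_def Let_def E_def flip: \<eta>_def)
  have hol_\<alpha>: "T.hol \<alpha> = ut \<eta> (- \<eta>)"
    using \<eta> E by (simp add: \<alpha>(5) g[unfolded One_nat_def] inv_ut ut_mult)
  have hol_\<beta>: "T.hol \<beta> = ut \<eta> (inverse \<eta>)"
    using \<eta> E by (simp add: \<beta>(5) g[unfolded One_nat_def] inv_ut ut_mult norm_divide field_simps)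
  define \<gamma> where "\<gamma> = (\<beta> +++ \<alpha>) +++ reversepath (\<alpha> +++ \<beta>)"
  have \<gamma>: "path \<gamma>" "path_image \<gamma> \<subseteq> punctured_plane n" "pathstart \<gamma> = \<i>" "pathfinish \<gamma> = \<i>"
    using \<alpha> \<beta> by (simp_all add: \<gamma>_def path_image_join)
  have "T.hol \<gamma> = (T.hol \<beta> ** T.hol \<alpha>) ** inv\<^bsub>UT\<^esub> (T.hol \<alpha> ** T.hol \<beta>)"
    unfolding \<gamma>_def using \<alpha> \<beta> by (simp add: path_image_join T.hol_join T.hol_reversepath)
  also have "\<dots> = ut 1 (1 - \<eta> ^ 4)"
    using \<eta> by (simp add: hol_\<alpha> hol_\<beta> ut_mult inv_ut norm_mult field_simps power4_eq_xxxx)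
  finally have "plane_hol n \<gamma> = ut 1 (1 - \<eta> ^ 4)"
    by (simp add: plane_hol_def)
  moreover have "1 - \<eta> ^ 4 \<noteq> 0"
  proof
    assume "1 - \<eta> ^ 4 = 0"
    then have "exp (4 * (pi * \<i> / n)) = 1"
      by (simp add: \<eta>_def exp_of_nat_mult[symmetric])
    then obtain k :: int where "4 * (pi / n) = of_int (2 * k) * pi"
      unfolding exp_eq_1 by auto
    then have "2 = of_int k * real n"
      using n by (simp add: field_simps)
    then have "real_of_int 2 = of_int (k * int n)"
      by simp
    then have "2 = k * int n"
      by (simp only: of_int_eq_iff)
    then have "int n dvd 2" by (metis dvd_triv_right)
    then show False
      using n by (auto dest: zdvd_imp_le)
  qed
  ultimately show ?thesis
    using \<gamma> that by blast
qed

section \<open>Elliptic and parabolic elements of PSL(2,C)\<close>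

definition proj :: "complex^2^2 \<Rightarrow> (complex^2^2) set" where
  "proj A = {mat 1, - mat 1} #>\<^bsub>SL2C\<^esub> A"

lemma proj_eq: "proj A = {A, - A}"
proof -
  have "(- mat 1) ** A = - A" by (rule matrix_mul_minus_mat1)
  then show ?thesis
    by (auto simp: proj_def r_coset_def SL2C_def)
qed

lemma proj_hom: "proj \<in> hom SL2C PSL2C"
  using normal.r_coset_hom_Mod[OF SL2C_center_normal] by (simp add: PSL2C_def proj_def[abs_def])

lemma proj_UT_hom: "proj \<in> hom UT PSL2C"
  using hom_compose[OF UT_hom_SL2C proj_hom] by (simp add: comp_def)

lemma one_PSL2C: "\<one>\<^bsub>PSL2C\<^esub> = {mat 1, - mat 1}"
  by (simp add: PSL2C_def FactGroup_def)

lemma PSL2C_proj_cases: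
  assumes "X \<in> carrier PSL2C" obtains A where "A \<in> carrier SL2C" "X = proj A"
  using assms by (auto simp: PSL2C_def FactGroup_def RCOSETS_def proj_def)

lemma proj_in_carrier: "A \<in> carrier SL2C \<Longrightarrow> proj A \<in> carrier PSL2C"
  using proj_hom by (auto simp: hom_def)

lemma continuous_map_proj: "continuous_map (top_of_set (carrier SL2C)) PSL2C_topology proj"
  unfolding continuous_map_def
proof (intro conjI allI impI)
  have "openin PSL2C_topology (carrier PSL2C)"
  proof -
    have "\<Union> (carrier PSL2C) = carrier SL2C"
    proof
      show "\<Union> (carrier PSL2C) \<subseteq> carrier SL2C"
        by (auto elim!: PSL2C_proj_cases simp: proj_eq SL2C_def det_2)
      show "carrier SL2C \<subseteq> \<Union> (carrier PSL2C)"
        using proj_in_carrier by (auto simp: proj_eq)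
    qed
    then show ?thesis
      unfolding openin_PSL2C by simp
  qed
  then have "topspace PSL2C_topology = carrier PSL2C"
    by (meson openin_PSL2C openin_subset openin_topspace subset_antisym)
  then show "proj \<in> topspace (top_of_set (carrier SL2C)) \<rightarrow> topspace PSL2C_topology"
    using proj_in_carrier by auto
  fix U assume U: "openin PSL2C_topology U"
  have "{A \<in> topspace (top_of_set (carrier SL2C)). proj A \<in> U} = \<Union> U"
  proof
    show "{A \<in> topspace (top_of_set (carrier SL2C)). proj A \<in> U} \<subseteq> \<Union> U"
      by (auto simp: proj_eq)
    show "\<Union> U \<subseteq> {A \<in> topspace (top_of_set (carrier SL2C)). proj A \<in> U}"
    proof
      fix A assume "A \<in> \<Union> U"
      then obtain X where X: "X \<in> U" "A \<in> X" by blast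
      then have Xc: "X \<in> carrier PSL2C" using U by (auto simp: openin_PSL2C)
      then have A: "A \<in> carrier SL2C"
        using X by (auto elim!: PSL2C_proj_cases simp: proj_eq SL2C_def det_2)
      have "A \<in> proj A" by (simp add: proj_eq)
      then have "proj A = X"
        using PSL2C_disjoint[OF proj_in_carrier[OF A] Xc] X by blast
      then show "A \<in> {A \<in> topspace (top_of_set (carrier SL2C)). proj A \<in> U}"
        using A X by simp
    qed
  qed
  then show "openin (top_of_set (carrier SL2C)) {A \<in> topspace (top_of_set (carrier SL2C)). proj A \<in> U}"
    using U by (simp add: openin_PSL2C)
qed

lemma proj_ut_eq_one_imp: "norm l = 1 \<Longrightarrow> proj (ut l m) = \<one>\<^bsub>PSL2C\<^esub> \<Longrightarrow> l\<^sup>2 = 1"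
proof -
  assume "proj (ut l m) = \<one>\<^bsub>PSL2C\<^esub>"
  then have "ut l m = mat 1 \<or> ut l m = - mat 1"
    by (auto simp: proj_eq one_PSL2C)
  then have "ut l m $ 1 $ 1 = 1 \<or> ut l m $ 1 $ 1 = - 1"
    by (elim disjE) (simp_all only: mat_def, simp_all)
  then show ?thesis
    by (auto simp: power2_eq_square)
qed

text \<open>
  A nontrivial rotation of \<open>\<complex>\<close> lies in the circle group \<open>C\<close>
  of all rotations with the same centre.
\<close>
lemma elliptic_proj_ut:
  assumes l: "norm l = 1" "l\<^sup>2 \<noteq> 1"
  shows "elliptic (proj (ut l m))"
proof -
  have l0: "l \<noteq> 0" using l by auto
  have lnz: "inverse l - l \<noteq> 0"
    using l l0 by (auto simp: field_simps power2_eq_square)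
  \<comment> \<open>Conjugating the diagonal matrix \<open>ut z 0\<close> by \<open>ut 1 x\<close> produces the upper right entry
    \<open>x * (inverse z - z)\<close>; this is \<open>m\<close> for \<open>z = l\<close>.\<close>
  define x where "x = m / (inverse l - l)"
  define C where "C z = ut z (x * (inverse z - z))" for z
  have Cm: "C z ** C w = C (z * w)" if "z \<noteq> 0" "w \<noteq> 0" for z w
    using that by (simp add: C_def ut_mult field_simps)
  define K where "K = proj ` C ` sphere 0 1"
  have SL: "C z \<in> carrier SL2C" if "norm z = 1" for z
    using that by (auto simp: C_def SL2C_def intro!: det_ut)
  interpret P: group PSL2C by (rule group_PSL2C)
  have mult: "proj (C z) \<otimes>\<^bsub>PSL2C\<^esub> proj (C w) = proj (C (z * w))" if "norm z = 1" "norm w = 1" for z w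
  proof -
    have "proj (C z) \<otimes>\<^bsub>PSL2C\<^esub> proj (C w) = proj (C z \<otimes>\<^bsub>SL2C\<^esub> C w)"
      using hom_mult[OF proj_hom SL SL] that by simp
    also have "C z \<otimes>\<^bsub>SL2C\<^esub> C w = C (z * w)"
      using that by (subst Cm[symmetric]) (auto simp: SL2C_def)
    finally show ?thesis .
  qed
  have "C 1 = mat 1"
    by (simp add: C_def ut_one)
  then have one: "proj (C 1) = \<one>\<^bsub>PSL2C\<^esub>"
    by (simp add: one_PSL2C proj_eq)
  have "subgroup K PSL2C"
  proof (rule P.subgroupI)
    show "K \<subseteq> carrier PSL2C" "K \<noteq> {}"
      using SL by (auto simp: K_def intro: proj_in_carrier)
    fix X assume "X \<in> K"
    then obtain z where z: "X = proj (C z)" "norm z = 1"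
      by (auto simp: K_def)
    then have "z \<noteq> 0" by auto
    then have "inv\<^bsub>PSL2C\<^esub> X = proj (C (inverse z))"
      using z mult[of "inverse z" z] one
      by (intro P.inv_equality) (auto simp: norm_inverse intro!: proj_in_carrier SL)
    then show "inv\<^bsub>PSL2C\<^esub> X \<in> K"
      using z by (auto simp: K_def norm_inverse)
    fix Y assume "Y \<in> K"
    then obtain w where w: "Y = proj (C w)" "norm w = 1"
      by (auto simp: K_def)
    then show "X \<otimes>\<^bsub>PSL2C\<^esub> Y \<in> K"
      using z mult by (auto simp: K_def norm_mult)
  qed
  moreover have "compactin PSL2C_topology K"
    unfolding K_def
  proof (rule image_compactin[OF _ continuous_map_proj])
    have "continuous_on (sphere 0 1) C"
    proof -
      have "C z = (\<chi> i j. if i = 1 then if j = 1 then z else x * (inverse z - z)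
                          else if j = 1 then 0 else inverse z)" for z
        by (simp add: C_def vec_eq_iff forall_2)
      moreover have "continuous_on (sphere 0 1) (\<lambda>z. if i = (1 :: 2) then if j = (1 :: 2) then z else x * (inverse z - z)
                          else if j = 1 then 0 else inverse z)" for i j
        by (cases "i = 1"; cases "j = 1") (auto intro!: continuous_intros)
      ultimately show ?thesis
        by (simp add: continuous_on_vec_lambda)
    qed
    then have "compact (C ` sphere 0 1)"
      by (rule compact_continuous_image) auto
    then show "compactin (top_of_set (carrier SL2C)) (C ` sphere 0 1)"
      using SL by (auto simp: compactin_subtopology)
  qed
  moreover have "C l = ut l m"
    using lnz by (simp add: C_def x_def)
  then have "proj (ut l m) \<in> K"
    using l by (auto simp: K_def image_iff intro!: bexI[of _ l])
  ultimately show ?thesis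
    unfolding elliptic_def compact_subgroup_def by blast
qed

text \<open>
  The powers of a nontrivial translation are unbounded, whereas the norm of the upper right
  entry, which does not depend on the choice between \<open>A\<close> and \<open>- A\<close>, is
  bounded on compact sets.
\<close>
lemma compact_subgroup_no_parabolic:
  assumes K: "compact_subgroup K" and s: "proj (ut 1 s) \<in> K"
  shows "s = 0"
proof (rule ccontr)
  assume "s \<noteq> 0"
  have sub: "subgroup K PSL2C" and comp: "compactin PSL2C_topology K"
    using K by (auto simp: compact_subgroup_def)
  have SL: "ut 1 m \<in> carrier SL2C" for m
    by (simp add: SL2C_def det_ut)
  have power: "proj (ut 1 (of_nat (Suc k) * s)) \<in> K" for k
  proof (induction k)
    case (Suc k)
    have "proj (ut 1 (of_nat (Suc k) * s)) \<otimes>\<^bsub>PSL2C\<^esub> proj (ut 1 s) \<in> K"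
      using Suc s subgroup.m_closed[OF sub] by blast
    also have "proj (ut 1 (of_nat (Suc k) * s)) \<otimes>\<^bsub>PSL2C\<^esub> proj (ut 1 s)
        = proj (ut 1 (of_nat (Suc k) * s) ** ut 1 s)"
      using hom_mult[OF proj_hom SL SL] by (simp add: SL2C_def)
    also have "ut 1 (of_nat (Suc k) * s) ** ut 1 s = ut 1 (of_nat (Suc (Suc k)) * s)"
      by (simp add: ut_mult algebra_simps)
    finally show ?case .
  qed (use s in simp)
  \<comment> \<open>An increasing open cover of the group by the sets where this norm is below \<open>k\<close>.\<close>
  define B where "B k = {X \<in> carrier PSL2C. \<forall>A\<in>X. norm (A $ 1 $ 2) < real k}" for k :: nat
  have "openin PSL2C_topology (B k)" for k
  proof -
    have "\<Union> (B k) = carrier SL2C \<inter> {A. norm (A $ 1 $ 2) < real k}"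
    proof
      show "\<Union> (B k) \<subseteq> carrier SL2C \<inter> {A. norm (A $ 1 $ 2) < real k}"
        by (auto simp: B_def elim!: PSL2C_proj_cases) (auto simp: proj_eq SL2C_def det_2)
      show "carrier SL2C \<inter> {A. norm (A $ 1 $ 2) < real k} \<subseteq> \<Union> (B k)"
      proof
        fix A assume "A \<in> carrier SL2C \<inter> {A. norm (A $ 1 $ 2) < real k}"
        then have "proj A \<in> B k" "A \<in> proj A"
          by (auto simp: B_def proj_in_carrier) (auto simp: proj_eq)
        then show "A \<in> \<Union> (B k)" by blast
      qed
    qed
    moreover have "open {A :: complex^2^2. norm (A $ 1 $ 2) < real k}"
      by (intro open_Collect_less continuous_intros)
    ultimately show ?thesis
      unfolding openin_PSL2C by (auto simp: B_def openin_open_Int)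
  qed
  moreover have "K \<subseteq> \<Union> (range B)"
  proof
    fix X assume "X \<in> K"
    then have Xc: "X \<in> carrier PSL2C"
      using subgroup.subset[OF sub] by blast
    then obtain A where A: "X = proj A"
      by (rule PSL2C_proj_cases)
    obtain k :: nat where "norm (A $ 1 $ 2) < k"
      using reals_Archimedean2 by blast
    then have "X \<in> B k"
      using Xc by (auto simp: B_def A proj_eq)
    then show "X \<in> \<Union> (range B)" by blast
  qed
  ultimately obtain \<F> where F: "finite \<F>" "\<F> \<subseteq> range B" "K \<subseteq> \<Union> \<F>"
    using compactinD[OF comp, of "range B"] by blast
  then obtain I where I: "finite I" "\<F> = B ` I"
    by (meson finite_subset_image)
  obtain M where M: "\<And>k. k \<in> I \<Longrightarrow> k \<le> M"
    using I(1) by (meson finite_nat_set_iff_bounded_le)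
  obtain k :: nat where k: "real M / norm s < real k"
    using reals_Archimedean2 by blast
  obtain i where "i \<in> I" "proj (ut 1 (of_nat (Suc k) * s)) \<in> B i"
    using power[of k] F I by blast
  then have "norm (of_nat (Suc k) * s) < real M"
    using M by (force simp: B_def proj_eq)
  then have "real (Suc k) * norm s < real M"
    by (simp only: norm_mult norm_of_nat)
  moreover have "real M < real k * norm s"
    using k \<open>s \<noteq> 0\<close> by (simp add: field_simps)
  ultimately show False
    by (simp add: algebra_simps) (smt (verit) norm_ge_zero)
qed

section \<open>Simple closed curves around punctures\<close>

text \<open>
  The outside of the curve is open and connected, so a homeomorphism \<open>f\<close> of the
  plane supported there can push the points of \<open>Z\<close> out of a large disc containing
  the curve. Its inverse \<open>g\<close> fixes the curve and carries the contraction of the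
  curve in the disc to one that avoids \<open>Z\<close>.
\<close>
lemma simple_closed_curve_null_homotopic:
  fixes c :: "real \<Rightarrow> complex"
  assumes c: "simple_path c" "pathfinish c = pathstart c" and Z: "finite Z" "Z \<subseteq> outside (path_image c)"
  shows "\<exists>a. homotopic_loops (- Z) c (linepath a a)"
proof -
  let ?O = "outside (path_image c)"
  have O: "open ?O" "connected ?O"
    using Jordan_inside_outside[OF c] by auto
  obtain R where R: "R > 0" "path_image c \<union> Z \<subseteq> ball 0 R"
  proof -
    have "bounded (path_image c \<union> Z)"
      using c Z by (simp add: bounded_path_image simple_path_imp_path finite_imp_bounded)
    then show ?thesis
      using that bounded_subset_ballD[of _ 0] by blast
  qed
  \<comment> \<open>A translation by \<open>2 * R\<close> moves the points of \<open>Z\<close> out of the disc and keeps them distinct.\<close>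
  have far: "z + of_real (2 * R) \<in> ?O \<and> z + of_real (2 * R) \<notin> ball 0 R" if "z \<in> Z" for z
  proof -
    have "norm (complex_of_real (2 * R)) \<le> norm (z + of_real (2 * R)) + norm z"
      using norm_triangle_ineq4[of "z + of_real (2 * R)" z] by simp
    moreover have "norm z < R"
      using R that by auto
    ultimately have "z + of_real (2 * R) \<notin> ball 0 R"
      using R(1) by simp
    then show ?thesis
      using outside_subset_convex[of "ball 0 R" "path_image c"] R(2) by auto
  qed
  have dim: "2 \<le> DIM(complex)" by simp
  have hull: "UNIV \<subseteq> affine hull ?O"
    using affine_hull_open[OF O(1)] Jordan_inside_outside[OF c] by simp
  obtain f g where fg: "homeomorphism UNIV UNIV f g" "\<And>z. z \<in> Z \<Longrightarrow> f z = z + of_real (2 * R)"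
    and supp: "{x. \<not> (f x = x \<and> g x = x)} \<subseteq> ?O"
    by (rule homeomorphism_moving_points_exists[OF dim O _ Z(1), of UNIV id "\<lambda>z. z + of_real (2 * R)"])
      (use Z(2) far O hull in \<open>auto simp: pairwise_def\<close>)
  have gc: "g (c t) = c t" if "t \<in> {0..1}" for t
  proof -
    have "c t \<in> path_image c"
      using that by (auto simp: path_image_def)
    then have "c t \<notin> ?O"
      using outside_no_overlap by blast
    then show ?thesis
      using supp by blast
  qed
  have gball: "g ` ball 0 R \<subseteq> - Z"
  proof clarify
    fix x assume "x \<in> ball 0 R" "g x \<in> Z"
    then show False
      using fg far[of "g x"] by (simp add: homeomorphism_def) (metis UNIV_I)
  qed
  have "homotopic_loops (ball 0 R) c (linepath (pathstart c) (pathstart c))"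
  proof (rule homotopic_loops_linear)
    fix t :: real assume "t \<in> {0..1}"
    then have "c t \<in> path_image c"
      by (auto simp: path_image_def)
    then have "c t \<in> ball 0 R" "pathstart c \<in> ball 0 R"
      using R(2) pathstart_in_path_image[of c] by blast+
    then show "closed_segment (c t) (linepath (pathstart c) (pathstart c) t) \<subseteq> ball 0 R"
      by (intro closed_segment_subset) auto
  qed (use c simple_path_imp_path in auto)
  moreover have "continuous_on (ball 0 R) g"
    using fg(1) by (auto simp: homeomorphism_def intro: continuous_on_subset)
  ultimately have "homotopic_loops (- Z) (g \<circ> c) (g \<circ> linepath (pathstart c) (pathstart c))"
    using gball by (intro homotopic_loops_continuous_image) auto
  moreover have "homotopic_loops (- Z) (g \<circ> c) c"
  proof (rule homotopic_loops_sym[OF homotopic_loops_eq])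
    show "path c" using c by (simp add: simple_path_imp_path)
    show "path_image c \<subseteq> - Z"
      using Z outside_no_overlap[of "path_image c"] by blast
  qed (use c gc in auto)
  moreover have "g \<circ> linepath (pathstart c) (pathstart c) = linepath (g (pathstart c)) (g (pathstart c))"
    by (auto simp: linepath_def fun_eq_iff algebra_simps)
  ultimately show ?thesis
    by (metis homotopic_loops_sym homotopic_loops_trans)
qed

text \<open>
  The winding number is constantly \<open>1\<close> or constantly \<open>- 1\<close> inside the
  curve and \<open>0\<close> outside, so no cancellation occurs: the sum counts the enclosed
  punctures up to sign. There is at least one of them, since otherwise the curve could be
  contracted.
\<close>
lemma winding_sum_simple_closed_curve:
  fixes c :: "real \<Rightarrow> complex"
  assumes c: "simple_path c" "pathfinish c = pathstart c" and Z: "finite Z" "path_image c \<subseteq> - Z"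
    and nontriv: "\<not> (\<exists>a. homotopic_loops (- Z) c (linepath a a))"
  obtains k :: int where "(\<Sum>z\<in>Z. winding_number c z) = of_int k" "1 \<le> \<bar>k\<bar>" "\<bar>k\<bar> \<le> int (card Z)"
proof -
  let ?I = "Z \<inter> inside (path_image c)"
  have IO: "Z \<subseteq> inside (path_image c) \<union> outside (path_image c)"
    using Z by (auto simp: inside_Un_outside)
  have "?I \<noteq> {}"
    using simple_closed_curve_null_homotopic[OF c Z(1)] nontriv IO by blast
  then have card: "1 \<le> card ?I" "card ?I \<le> card Z"
    using Z(1) by (auto simp: Suc_le_eq card_gt_0_iff intro: card_mono)
  have out: "winding_number c z = 0" if "z \<in> Z - ?I" for z
    using winding_number_zero_in_outside[OF simple_path_imp_path[OF c(1)] c(2)] IO that by blast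
  have sum: "(\<Sum>z\<in>Z. winding_number c z) = (\<Sum>z\<in>?I. winding_number c z)"
    using Z(1) out by (intro sum.mono_neutral_right) auto
  show ?thesis
  proof (rule simple_closed_path_winding_number_inside[OF c(1)])
    assume 1: "\<And>z. z \<in> inside (path_image c) \<Longrightarrow> winding_number c z = 1"
    then have "(\<Sum>z\<in>?I. winding_number c z) = of_int (int (card ?I))" by simp
    then show ?thesis
      using that[of "int (card ?I)"] sum card by simp
  next
    assume 1: "\<And>z. z \<in> inside (path_image c) \<Longrightarrow> winding_number c z = - 1"
    then have "(\<Sum>z\<in>?I. winding_number c z) = of_int (- int (card ?I))" by simp
    then show ?thesis
      using that[of "- int (card ?I)"] sum card by simp
  qed
qed

text \<open>
  One puncture is sent to infinity, and a homeomorphism of the plane moves the others and the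
  base point to prescribed distinct positions.
\<close>
lemma punctured_sphere_coordinates:
  assumes P: "P \<subseteq> sphere 0 1" "finite P" "card P = n" "n \<ge> 3" and x0: "x0 \<in> punctured_sphere P"
  obtains F F' where "homeomorphism (punctured_sphere P) (punctured_plane n) F F'" "F x0 = \<i>"
proof -
  obtain p where p: "p \<in> P"
    using P by fastforce
  have "sphere 0 1 - {p} homeomorphic (UNIV :: complex set)"
    by (rule homeomorphic_punctured_sphere_affine) (use p P in auto)
  then obtain f f' where f: "homeomorphism (sphere 0 1 - {p}) (UNIV :: complex set) f f'"
    unfolding homeomorphic_def by blast
  have inj: "inj_on f (sphere 0 1 - {p})"
    by (rule inj_on_inverseI[where g = "f'"]) (rule homeomorphism_apply1[OF f])
  let ?Q = "P - {p}"
  have Q: "?Q \<subseteq> sphere 0 1 - {p}" "finite ?Q" "card ?Q = n - 1"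
    using P p by auto
  obtain e where e: "bij_betw e ?Q {1..<n}"
    using finite_same_card_bij[of ?Q "{1..<n}"] Q by auto
  define y where "y x = (if x = x0 then \<i> else complex_of_real (real (e x)))" for x
  have x0': "x0 \<in> sphere 0 1 - {p}" "x0 \<notin> ?Q"
    using x0 p by (auto simp: punctured_sphere_def)
  have dim: "2 \<le> DIM(complex)" by simp
  have inj_y: "inj_on y (insert x0 ?Q)"
  proof (rule inj_onI)
    fix u v assume uv: "u \<in> insert x0 ?Q" "v \<in> insert x0 ?Q" "y u = y v"
    have "u = x0 \<longleftrightarrow> v = x0"
      using arg_cong[OF uv(3), of Im] by (auto simp: y_def split: if_splits)
    then show "u = v"
      using uv bij_betw_imp_inj_on[OF e] by (cases "u = x0") (auto simp: y_def dest: inj_onD)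
  qed
  obtain g g' where g: "homeomorphism UNIV UNIV g g'" "\<And>x. x \<in> insert x0 ?Q \<Longrightarrow> g (f x) = y x"
  proof (rule homeomorphism_moving_points_exists[OF dim open_UNIV connected_UNIV subset_UNIV, of "insert x0 ?Q" f y])
    show "pairwise (\<lambda>i j. f i \<noteq> f j \<and> y i \<noteq> y j) (insert x0 ?Q)"
      using inj inj_y Q(1) x0'(1) unfolding pairwise_def inj_on_def by blast
  qed (use Q in auto)
  have gf: "homeomorphism (sphere 0 1 - {p}) UNIV (g \<circ> f) (f' \<circ> g')"
    using homeomorphism_compose[OF f g(1)] .
  have img: "(g \<circ> f) ` ?Q = complex_of_real ` real ` {1..<n}"
  proof -
    have "(g \<circ> f) ` ?Q = (\<lambda>x. complex_of_real (real (e x))) ` ?Q"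
      using g(2) x0'(2) by (intro image_cong) (auto simp: y_def)
    also have "\<dots> = complex_of_real ` real ` e ` ?Q"
      by (simp add: image_image)
    finally show ?thesis
      using e by (simp add: bij_betw_def)
  qed
  have inj_gf: "inj_on (g \<circ> f) (sphere 0 1 - {p})"
    by (rule inj_on_inverseI[where g = "f' \<circ> g'"]) (rule homeomorphism_apply1[OF gf])
  have sub: "punctured_sphere P = (sphere 0 1 - {p}) - ?Q"
    using p by (auto simp: punctured_sphere_def)
  have "(g \<circ> f) ` punctured_sphere P = punctured_plane n"
    unfolding sub inj_on_image_set_diff[OF inj_gf Diff_subset Q(1)] img
    using gf by (auto simp: homeomorphism_def punctured_plane_def)
  then have "homeomorphism (punctured_sphere P) (punctured_plane n) (g \<circ> f) (f' \<circ> g')"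
    using gf by (rule_tac homeomorphism_of_subsets) (auto simp: punctured_sphere_def p)
  moreover have "(g \<circ> f) x0 = \<i>"
    using g(2)[of x0] by (simp add: y_def)
  ultimately show ?thesis
    using that by blast
qed

section \<open>Reducible totally elliptic representations\<close>

theorem theorem4:
  fixes n :: nat and P :: "(real^3) set" and x0 :: "real^3"
  assumes "n \<ge> 3"
    and "P \<subseteq> sphere 0 1" and "finite P" and "card P = n"
    and "x0 \<in> punctured_sphere P"
  shows "\<exists>\<rho>. representation P x0 \<rho> \<and> reduced P x0 \<rho> \<and> totally_elliptic P x0 \<rho> \<and>
             reducible P x0 \<rho> \<and> \<not> unitary P x0 \<rho>"
proof -
  let ?S = "punctured_sphere P" and ?X = "punctured_plane n"
  let ?\<Pi> = "fundamental_group ?S x0"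
  obtain F F' where F: "homeomorphism ?S ?X F F'" and Fx0: "F x0 = \<i>"
    using punctured_sphere_coordinates assms by blast
  interpret T: local_cocycle UT ?X "group.cross UT (twist n)"
    by (rule local_cocycle_twist[OF assms(1)])
  have Fc: "continuous_on ?S F" "F ` ?S \<subseteq> ?X" and F'c: "continuous_on ?X F'" "F' ` ?X \<subseteq> ?S"
    using F by (auto simp: homeomorphism_def)
  define \<tau> where "\<tau> \<gamma> = plane_hol n (F \<circ> (SOME p. p \<in> \<gamma>))" for \<gamma>
  define \<rho> where "\<rho> \<gamma> = proj (\<tau> \<gamma>)" for \<gamma>
  have \<tau>_hom: "\<tau> \<in> hom ?\<Pi> UT"
    using T.hol_compose_hom[OF Fc] by (simp add: \<tau>_def[abs_def] plane_hol_def)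
  have \<tau>_eq: "\<tau> \<gamma> = plane_hol n (F \<circ> p)" if "\<gamma> \<in> carrier ?\<Pi>" "p \<in> \<gamma>" for \<gamma> p
    using T.hol_compose_class[OF Fc that(2,1)] by (simp add: \<tau>_def plane_hol_def)
  have rep: "representation P x0 \<rho>"
    using hom_compose[OF \<tau>_hom proj_UT_hom] by (simp add: representation_def \<rho>_def[abs_def] comp_def)
  have simple: "\<exists>l m. \<tau> \<gamma> = ut l m \<and> norm l = 1 \<and> l\<^sup>2 \<noteq> 1"
    if \<gamma>: "\<gamma> \<in> carrier ?\<Pi>" and c: "simple_closed_curve ?S c" "represents_curve ?S \<gamma> c" for \<gamma> c
  proof -
    obtain p where p: "p \<in> \<gamma>" "homotopic_loops ?S p c"
      using c(2) by (auto simp: represents_curve_def)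
    have Fp: "homotopic_loops ?X (F \<circ> p) (F \<circ> c)"
      using homotopic_loops_continuous_image[OF p(2) Fc(1)] Fc(2) by auto
    have cS: "path_image c \<subseteq> ?S" "simple_path c" "pathfinish c = pathstart c"
      using c(1) by (auto simp: simple_closed_curve_def)
    have "inj_on F ?S"
      by (rule inj_on_inverseI[where g = "F'"]) (rule homeomorphism_apply1[OF F])
    then have Fcs: "simple_path (F \<circ> c)" "pathfinish (F \<circ> c) = pathstart (F \<circ> c)"
      using cS Fc by (auto simp: pathfinish_compose pathstart_compose
          intro!: simple_path_continuous_image elim: continuous_on_subset inj_on_subset)
    let ?Z = "complex_of_real ` real ` {1..<n}"
    have XZ: "?X = - ?Z"
      by (simp add: punctured_plane_def)
    have nontrivial: "\<not> (\<exists>a. homotopic_loops (- ?Z) (F \<circ> c) (linepath a a))"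
    proof
      assume "\<exists>a. homotopic_loops (- ?Z) (F \<circ> c) (linepath a a)"
      then obtain a where "homotopic_loops ?X (F \<circ> c) (linepath a a)"
        unfolding XZ by blast
      then have "homotopic_loops ?S (F' \<circ> (F \<circ> c)) (F' \<circ> linepath a a)"
        using F'c by (intro homotopic_loops_continuous_image) auto
      moreover have "F' \<circ> linepath a a = linepath (F' a) (F' a)"
        by (auto simp: linepath_def fun_eq_iff algebra_simps)
      moreover have "F' (F (c t)) = c t" if "t \<in> {0..1}" for t
      proof -
        have "c t \<in> ?S"
          using cS(1) that by (auto simp: path_image_def)
        then show ?thesis
          by (rule homeomorphism_apply1[OF F])
      qed
      then have "homotopic_loops ?S c (F' \<circ> (F \<circ> c))"
        using cS by (intro homotopic_loops_eq) (auto simp: simple_path_imp_path)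
      ultimately show False
        using c(1) homotopic_loops_trans unfolding simple_closed_curve_def by metis
    qed
    have fin: "finite ?Z" and image: "path_image (F \<circ> c) \<subseteq> - ?Z"
      using cS Fc XZ by (auto simp: path_image_compose)
    obtain k :: int where k: "(\<Sum>z\<in>?Z. winding_number (F \<circ> c) z) = of_int k"
        "1 \<le> \<bar>k\<bar>" "\<bar>k\<bar> \<le> int (card ?Z)"
      by (rule winding_sum_simple_closed_curve[OF Fcs fin image nontrivial])
    have inj: "inj_on (complex_of_nat) {1..<n}"
      by (auto simp: inj_on_def)
    have Z': "?Z = complex_of_nat ` {1..<n}"
      by (simp add: image_image)
    have k': "\<bar>k\<bar> < int n"
      using k(3) assms(1) card_image_le[of "{1..<n}" complex_of_nat] unfolding Z' by simp
    have w: "winding_number (F \<circ> p) (of_nat j) = winding_number (F \<circ> c) (of_nat j)" if "j \<in> {1..<n}" for j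
    proof (rule winding_number_homotopic_loops, rule homotopic_loops_subset[OF Fp])
      show "?X \<subseteq> - {of_nat j}"
        using that unfolding XZ Z' by blast
    qed
    have "(\<Sum>j\<in>{1..<n}. winding_number (F \<circ> p) (of_nat j)) = of_int k"
      using k(1) w unfolding Z' sum.reindex[OF inj] by simp
    then have diag: "\<tau> \<gamma> $ 1 $ 1 = exp (pi * \<i> / n * of_int k)"
      using homotopic_loops_imp_path[OF Fp] homotopic_loops_imp_subset[OF Fp] homotopic_loops_imp_loop[OF Fp]
      by (simp add: \<tau>_eq[OF \<gamma> p(1)] plane_hol_diagonal[OF assms(1)])
    have "\<tau> \<gamma> \<in> carrier UT"
      using \<tau>_hom \<gamma> by (auto simp: hom_def)
    then obtain l m where lm: "\<tau> \<gamma> = ut l m" "norm l = 1"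
      by (rule UT_cases)
    have "l\<^sup>2 \<noteq> 1"
    proof
      assume "l\<^sup>2 = 1"
      then have "exp (2 * (pi * \<i> / n * of_int k)) = 1"
        using lm diag unfolding exp_double by simp
      then obtain i :: int where "2 * (pi / n * of_int k) = of_int (2 * i) * pi"
        unfolding exp_eq_1 by auto
      then have "real_of_int k = of_int (i * int n)"
        using assms(1) by (simp add: field_simps)
      then have "k = i * int n"
        by (simp only: of_int_eq_iff)
      then have "int n dvd k" by (metis dvd_triv_right)
      then have "int n \<le> \<bar>k\<bar>"
        using k(2) dvd_imp_le_int[of k "int n"] by fastforce
      then show False
        using k' by simp
    qed
    then show ?thesis
      using lm by blast
  qed
  have ell: "totally_elliptic P x0 \<rho>"
    unfolding totally_elliptic_def \<rho>_def using simple elliptic_proj_ut by metis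
  have red: "reduced P x0 \<rho>"
    unfolding reduced_def peripheral_curve_def \<rho>_def using simple proj_ut_eq_one_imp by metis
  have "reducible P x0 \<rho>"
    unfolding reducible_def
  proof (intro bexI ballI)
    interpret PG: group PSL2C by (rule group_PSL2C)
    show "\<one>\<^bsub>PSL2C\<^esub> \<in> carrier PSL2C" by simp
    fix \<gamma> assume "\<gamma> \<in> carrier ?\<Pi>"
    then have "\<rho> \<gamma> \<in> carrier PSL2C" "\<tau> \<gamma> \<in> carrier UT"
      using rep \<tau>_hom by (auto simp: representation_def hom_def)
    then show "\<one>\<^bsub>PSL2C\<^esub> \<otimes>\<^bsub>PSL2C\<^esub> \<rho> \<gamma> \<otimes>\<^bsub>PSL2C\<^esub> inv\<^bsub>PSL2C\<^esub> \<one>\<^bsub>PSL2C\<^esub> \<in> upper_triangular_PSL2C"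
      by (auto simp: upper_triangular_PSL2C_def \<rho>_def proj_eq elim!: UT_cases)
  qed
  moreover have "\<not> unitary P x0 \<rho>"
  proof
    assume "unitary P x0 \<rho>"
    then obtain K where K: "compact_subgroup K" "\<rho> ` carrier ?\<Pi> \<subseteq> K"
      by (auto simp: unitary_def)
    obtain \<gamma> s where \<gamma>: "path \<gamma>" "path_image \<gamma> \<subseteq> ?X" "pathstart \<gamma> = \<i>" "pathfinish \<gamma> = \<i>"
      "plane_hol n \<gamma> = ut 1 s" "s \<noteq> 0"
      using parabolic_loop[OF assms(1)] .
    have F'i: "F' \<i> = x0"
      using F Fx0 assms(5) by (metis homeomorphism_apply1)
    have "F' \<circ> \<gamma> \<in> loops_at ?S x0"
      using \<gamma> F'c F'i by (auto simp: loops_at_def path_image_compose pathstart_compose pathfinish_compose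
          intro!: path_continuous_image elim: continuous_on_subset)
    then have cls: "loop_class ?S (F' \<circ> \<gamma>) \<in> carrier ?\<Pi>" "F' \<circ> \<gamma> \<in> loop_class ?S (F' \<circ> \<gamma>)"
      by (auto simp: fundamental_group_def loop_class_def loops_at_def)
    have "F (F' (\<gamma> t)) = \<gamma> t" if "t \<in> {0..1}" for t
    proof -
      have "\<gamma> t \<in> ?X"
        using \<gamma>(2) that by (auto simp: path_image_def)
      then show ?thesis
        by (rule homeomorphism_apply2[OF F])
    qed
    then have "T.hol \<gamma> = T.hol (F \<circ> (F' \<circ> \<gamma>))"
      using \<gamma> by (intro T.hol_cong) auto
    then have "\<tau> (loop_class ?S (F' \<circ> \<gamma>)) = ut 1 s"
      using \<tau>_eq[OF cls] \<gamma>(5) by (simp add: plane_hol_def)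
    then have "proj (ut 1 s) \<in> K"
      using K(2) cls(1) by (auto simp: \<rho>_def)
    then show False
      using compact_subgroup_no_parabolic[OF K(1)] \<gamma>(6) by blast
  qed
  ultimately show ?thesis
    using rep red ell by blast
qed

end
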